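(* Let $\Delta^+ = \Delta^+(p,q,r)$ be a non-perfect hyperbolic ordinary triangle group. Then: (a) $\Delta^+$ has a smooth finite soluble quotient with derived length at most $3$; (b) if $c$ denotes the minimum derived length of a smooth finite soluble quotient of $\Delta^+$, then for every integer $d > c$, $\Delta^+$ has infinitely many smooth finite soluble quotients with derived length $d$. In particular, $\Delta^+$ has infinitely many smooth finite soluble quotients with derived length $d$ for every integer $d > 3$.
   Context: For integers $p,q,r\ge 2$, the ordinary triangle group is $\Delta^+(p,q,r)=\langle x,y \mid x^p=y^q=(xy)^r=1\rangle$. It is hyperbolic if $1/p+1/q+1/r<1$. A group is perfect if it equals its derived (commutator) subgroup. A quotient $G$ of $\Delta^+(p,q,r)$ (i.e. the image of a surjective homomorphism $\varphi$, equivalently $\Delta^+(p,q,r)/\ker\varphi$) is called smooth if $\varphi(x),\varphi(y),\varphi(xy)$ have orders exactly $p,q,r$ respectively; equivalently, $\ker\varphi$ is torsion-free. Distinct quotients are counted as distinct normal subgroups (kernels). The derived length of a soluble group $G$ is the least $d$ with $G^{(d)}=1$, where $G^{(0)}=G$ and $G^{(i+1)}=[G^{(i)},G^{(i)}]$. *)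

theory Defs
  imports Complex_Main "HOL-Algebra.Algebra"
begin

text \<open>Words in the free group on two generators x, y: a letter is
  (is_x, inverted).\<close>
type_synonym tword = "(bool \<times> bool) list"

fun evw :: "('a, 'b) monoid_scheme \<Rightarrow> 'a \<Rightarrow> 'a \<Rightarrow> tword \<Rightarrow> 'a" where
  "evw G a b [] = \<one>\<^bsub>G\<^esub>"
| "evw G a b ((g, i) # w) =
     (let c = (if g then a else b) in if i then inv\<^bsub>G\<^esub> c else c) \<otimes>\<^bsub>G\<^esub> evw G a b w"

text \<open>Two words are equal in the triangle group iff they are equal in every
  group satisfying the defining relations.  Since the triangle group is countable
  it is isomorphic to a group with carrier contained in nat, so quantifying
  over such groups suffices.\<close>
definition tri_rel :: "nat \<Rightarrow> nat \<Rightarrow> nat \<Rightarrow> tword \<Rightarrow> tword \<Rightarrow> bool" where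
  "tri_rel p q r w v \<longleftrightarrow>
     (\<forall>(G :: nat monoid) a b. group G \<and> a \<in> carrier G \<and> b \<in> carrier G \<and>
        a [^]\<^bsub>G\<^esub> p = \<one>\<^bsub>G\<^esub> \<and> b [^]\<^bsub>G\<^esub> q = \<one>\<^bsub>G\<^esub> \<and>
        (a \<otimes>\<^bsub>G\<^esub> b) [^]\<^bsub>G\<^esub> r = \<one>\<^bsub>G\<^esub>
        \<longrightarrow> evw G a b w = evw G a b v)"

definition triangle_group :: "nat \<Rightarrow> nat \<Rightarrow> nat \<Rightarrow> tword set monoid" where
  "triangle_group p q r =
     \<lparr> carrier = UNIV // {(w, v). tri_rel p q r w v},
       monoid.mult = (\<lambda>A B. {w. \<exists>u\<in>A. \<exists>v\<in>B. tri_rel p q r w (u @ v)}),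
       one = {w. tri_rel p q r w []} \<rparr>"

definition tri_x :: "nat \<Rightarrow> nat \<Rightarrow> nat \<Rightarrow> tword set" where
  "tri_x p q r = {w. tri_rel p q r w [(True, False)]}"

definition tri_y :: "nat \<Rightarrow> nat \<Rightarrow> nat \<Rightarrow> tword set" where
  "tri_y p q r = {w. tri_rel p q r w [(False, False)]}"

definition perfect_group :: "('a, 'b) monoid_scheme \<Rightarrow> bool" where
  "perfect_group G \<longleftrightarrow> derived G (carrier G) = carrier G"

definition derived_length :: "('a, 'b) monoid_scheme \<Rightarrow> nat" where
  "derived_length G = (LEAST d. (derived G ^^ d) (carrier G) = {\<one>\<^bsub>G\<^esub>})"

definition smooth_fin_sol_quotient :: "nat \<Rightarrow> nat \<Rightarrow> nat \<Rightarrow> tword set set \<Rightarrow> bool" where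
  "smooth_fin_sol_quotient p q r N \<longleftrightarrow>
     (let T = triangle_group p q r; Q = T Mod N in
       N \<lhd> T \<and> finite (carrier Q) \<and> solvable Q \<and>
       group.ord Q (N #>\<^bsub>T\<^esub> tri_x p q r) = p \<and>
       group.ord Q (N #>\<^bsub>T\<^esub> tri_y p q r) = q \<and>
       group.ord Q (N #>\<^bsub>T\<^esub> (tri_x p q r \<otimes>\<^bsub>T\<^esub> tri_y p q r)) = r)"

end

theory Submission
  imports Defs "HOL-Library.Function_Algebras"
begin

text \<open>Both parts rest on split extensions \<open>V \<rtimes> G\<close> of a finite group \<open>G\<close> by a module \<open>V\<close> of functions
  on \<open>G\<close> with values in the \<open>n\<close>-torsion of \<open>\<rat>/\<int>\<close>.

  (a) If \<open>n \<ge> 2\<close> divides two of the periods, say \<open>p\<close> and \<open>q\<close>, two such extensions starting from the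
  cyclic group of order \<open>n\<close> produce elements \<open>a, b\<close> of orders \<open>p, q\<close> with \<open>ab\<close> of order \<open>r\<close>.  The other
  two cases follow by permuting the triple \<open>(a, b, (ab)\<^sup>-\<^sup>1)\<close>.

  (b) Let \<open>G\<close> be a smooth quotient of derived length \<open>k + 1\<close>, let \<open>S = G\<^sup>(\<^sup>k\<^sup>)\<close>, let \<open>l\<close> be a prime not
  dividing \<open>|G|\<close>, and let \<open>V\<close> consist of the functions with values in the \<open>l\<close>-torsion whose sums over
  all translates of \<open>S\<close> vanish, so that \<open>V\<^sup>S = 0\<close>.  If a derivation \<open>\<delta>: \<Delta>\<^sup>+ \<rightarrow> V\<close> vanished on
  \<open>\<Delta>\<^sup>+\<^sup>(\<^sup>k\<^sup>+\<^sup>1\<^sup>)\<close>, then its values on the kernel of \<open>\<Delta>\<^sup>+ \<rightarrow> G\<close> would be fixed by \<open>S\<close>, hence zero, so \<open>\<delta>\<close>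
  would be a derivation of \<open>G\<close> and therefore principal.  Counting fixed points shows that
  \<open>1/p + 1/q + 1/r < 1\<close> forces the existence of a non-principal derivation.  The corresponding
  subgroup of \<open>V \<rtimes> G\<close> is a smooth quotient of derived length \<open>k + 2\<close> and of order at least \<open>l\<close>.\<close>

subsection \<open>Torsion in abelian groups\<close>

definition nmul :: "nat \<Rightarrow> 'v::ab_group_add \<Rightarrow> 'v" where
  "nmul n v = (\<Sum>i<n. v)"

lemma nmul_0 [simp]: "nmul 0 v = 0"
  and nmul_Suc [simp]: "nmul (Suc n) v = nmul n v + v"
  by (simp_all add: nmul_def)

lemma nmul_zero_right [simp]: "nmul n 0 = 0"
  by (simp add: nmul_def)

lemma nmul_add: "nmul (m + n) v = nmul m v + nmul n v"
  by (induction n) (simp_all add: add.assoc)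

lemma nmul_mult: "nmul (m * n) v = nmul m (nmul n v)"
  by (induction m) (simp_all add: nmul_add add.commute)

lemma nmul_add_right: "nmul n (v + w) = nmul n v + nmul n w"
  by (simp add: nmul_def sum.distrib)

lemma nmul_diff_right: "nmul n (v - w) = nmul n v - nmul n w"
  by (simp add: nmul_def sum_subtractf)

lemma nmul_uminus_right: "nmul n (- v) = - nmul n v"
  by (simp add: nmul_def sum_negf)

lemma sum_const_nmul: "finite A \<Longrightarrow> (\<Sum>i\<in>A. v) = nmul (card A) v"
  by (induction A rule: finite_induct) (simp_all add: add.commute)

lemma nmul_fun: "nmul n f k = nmul n (f k)"
  by (induction n) simp_all

text \<open>Bezout: a combination of \<open>m\<close> and \<open>n\<close> equal to \<open>1\<close>
  kills \<open>v\<close>. The case \<open>m = 0\<close> is split off because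
  \<open>bezout_nat\<close> wants a nonzero first argument; there coprimality forces
  \<open>n = 1\<close>.\<close>

lemma nmul_coprime_eq_0:
  assumes "coprime m n" "nmul m v = 0" "nmul n v = 0"
  shows "v = 0"
proof (cases "m = 0")
  case True
  then show ?thesis using assms by simp
next
  case False
  then obtain x y where "m * x = n * y + 1"
    using bezout_nat[OF False, of n] assms(1) by auto
  then have "nmul (x * m) v = nmul (y * n + 1) v" by (simp add: mult.commute)
  then show ?thesis using assms(2,3)
    by (simp add: nmul_mult nmul_add)
qed

text \<open>A single type containing a cyclic group of every finite order.\<close>

quotient_type qz = rat / "\<lambda>a b. a - b \<in> \<int>"
proof (rule equivpI)
  show "symp (\<lambda>a b::rat. a - b \<in> \<int>)"
    by (rule sympI) (metis Ints_minus minus_diff_eq)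
  show "transp (\<lambda>a b::rat. a - b \<in> \<int>)"
    by (rule transpI) (metis Ints_add diff_add_cancel add_diff_eq)
qed (auto simp: reflp_def)

instantiation qz :: ab_group_add
begin
lift_definition zero_qz :: qz is 0 .
lift_definition plus_qz :: "qz \<Rightarrow> qz \<Rightarrow> qz" is "(+)"
  by (metis Ints_add add_diff_add)
lift_definition uminus_qz :: "qz \<Rightarrow> qz" is uminus
  by (metis Ints_minus minus_diff_minus)
lift_definition minus_qz :: "qz \<Rightarrow> qz \<Rightarrow> qz" is "(-)"
  by (metis Ints_diff diff_diff_eq2 diff_add_eq diff_diff_add add.commute diff_diff_eq)
instance
  by standard (transfer; simp add: algebra_simps)+
end

lift_definition qz_of :: "rat \<Rightarrow> qz" is "\<lambda>x. x" .

lemma qz_of_add: "qz_of (x + y) = qz_of x + qz_of y"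
  by transfer simp

lemma qz_of_eq_0_iff: "qz_of x = 0 \<longleftrightarrow> x \<in> \<int>"
  by transfer simp

lemma qz_of_surj: "\<exists>y. x = qz_of y"
  by transfer (metis Ints_0 diff_self)

lemma nmul_qz_of: "nmul n (qz_of x) = qz_of (of_nat n * x)"
proof (induction n)
  case 0
  have "qz_of 0 = 0" by (simp add: qz_of_eq_0_iff)
  then show ?case by simp
qed (simp add: qz_of_add[symmetric] algebra_simps)

text \<open>Source of all elements of prescribed additive order below: \<open>k / n\<close> is an
  integer exactly when \<open>n\<close> divides \<open>k\<close>.\<close>

lemma nmul_qz_of_inverse_eq_0_iff:
  assumes "n > 0"
  shows "nmul k (qz_of (1 / of_nat n)) = 0 \<longleftrightarrow> n dvd k"
proof
  assume "nmul k (qz_of (1 / of_nat n)) = 0"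
  then obtain z :: int where "of_nat k / (of_nat n :: rat) = of_int z"
    by (auto simp: nmul_qz_of qz_of_eq_0_iff elim: Ints_cases)
  then have "(of_int (int k) :: rat) = of_int (z * int n)"
    using assms by (simp add: field_simps)
  then have "int k = z * int n" by (simp only: of_int_eq_iff)
  then have "int n dvd int k" by simp
  then show "n dvd k" by (simp only: int_dvd_int_iff)
next
  assume "n dvd k"
  then obtain m where "k = n * m" by auto
  then have "of_nat k * (1 / of_nat n) = (of_nat m :: rat)" using assms by simp
  then show "nmul k (qz_of (1 / of_nat n)) = 0"
    by (simp add: nmul_qz_of qz_of_eq_0_iff)
qed

definition torsion :: "nat \<Rightarrow> 'v::ab_group_add set" where
  "torsion n = {v. nmul n v = 0}"

text \<open>If \<open>n x\<close> is the integer \<open>z\<close>, then \<open>x\<close> differs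
  from \<open>(z mod n) / n\<close> by the integer \<open>z div n\<close>, so at most
  \<open>n\<close> classes occur.\<close>

lemma finite_torsion_qz:
  assumes "n > 0"
  shows "finite (torsion n :: qz set)"
proof (rule finite_subset)
  show "torsion n \<subseteq> (\<lambda>k. qz_of (of_nat k / of_nat n)) ` {..<n}"
  proof
    fix v :: qz assume v: "v \<in> torsion n"
    obtain x where x: "v = qz_of x" using qz_of_surj by blast
    obtain z :: int where z: "of_nat n * x = of_int z"
      using v by (auto simp: torsion_def x nmul_qz_of qz_of_eq_0_iff elim: Ints_cases)
    define k where "k = nat (z mod int n)"
    have k: "k < n" "int k = z mod int n"
      using assms by (simp_all add: k_def nat_less_iff)
    have "z = int n * (z div int n) + int k" using k by simp
    then have "(of_int z :: rat) = of_nat n * of_int (z div int n) + of_nat k"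
      by (metis of_int_add of_int_mult of_int_of_nat_eq)
    then have "x = of_nat k / of_nat n + of_int (z div int n)"
      using z assms by (simp add: field_simps)
    moreover have "qz_of (of_int (z div int n)) = 0" by (simp add: qz_of_eq_0_iff)
    ultimately have "v = qz_of (of_nat k / of_nat n)" by (simp add: x qz_of_add)
    with k show "v \<in> (\<lambda>k. qz_of (of_nat k / of_nat n)) ` {..<n}" by auto
  qed
qed simp

lemma card_torsion_qz:
  assumes "n \<ge> 2"
  shows "card (torsion n :: qz set) \<ge> 2"
proof -
  let ?e = "qz_of (1 / of_nat n)"
  have e: "?e \<in> torsion n" using assms by (simp add: torsion_def nmul_qz_of_inverse_eq_0_iff)
  have "nmul 1 ?e \<noteq> 0" using assms by (subst nmul_qz_of_inverse_eq_0_iff) auto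
  then have "?e \<noteq> 0" by auto
  then have "card {0, ?e} = 2" by simp
  moreover have "{0, ?e} \<subseteq> torsion n" using e by (simp add: torsion_def)
  ultimately show ?thesis
    using card_mono[OF finite_torsion_qz[of n]] assms by (metis less_le_trans pos2)
qed

lemma torsion_closed:
  "0 \<in> torsion n" "v \<in> torsion n \<Longrightarrow> w \<in> torsion n \<Longrightarrow> v + w \<in> torsion n"
  "v \<in> torsion n \<Longrightarrow> - v \<in> torsion n"
  by (simp_all add: torsion_def nmul_add_right nmul_uminus_right)

subsection \<open>Modules, split extensions and derivations\<close>

text \<open>The module is a subset \<open>V\<close> of an ambient group, so that submodules such as
  \<open>sum_zero S\<close> carry the same action on the same type. Additivity is demanded on the
  whole type, which lets the action pass through sums without membership conditions.\<close>

locale gmod = group G for G (structure) +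
  fixes act :: "'a \<Rightarrow> 'v::ab_group_add \<Rightarrow> 'v" and V :: "'v set"
  assumes zero_V [simp]: "0 \<in> V"
    and add_V [simp]: "\<lbrakk>v \<in> V; w \<in> V\<rbrakk> \<Longrightarrow> v + w \<in> V"
    and uminus_V [simp]: "v \<in> V \<Longrightarrow> - v \<in> V"
    and act_V [simp]: "\<lbrakk>g \<in> carrier G; v \<in> V\<rbrakk> \<Longrightarrow> act g v \<in> V"
    and act_add: "act g (v + w) = act g v + act g w"
    and act_mult: "\<lbrakk>g \<in> carrier G; h \<in> carrier G; v \<in> V\<rbrakk> \<Longrightarrow> act (g \<otimes> h) v = act g (act h v)"
    and act_one [simp]: "v \<in> V \<Longrightarrow> act \<one> v = v"
begin

lemma diff_V [simp]: "\<lbrakk>v \<in> V; w \<in> V\<rbrakk> \<Longrightarrow> v - w \<in> V"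
  using add_V[of v "- w"] by simp

lemma act_zero [simp]: "act g 0 = 0"
  using act_add[of g 0 0] by simp

lemma act_uminus: "act g (- v) = - act g v"
  using act_add[of g v "- v"] by (simp add: eq_neg_iff_add_eq_0 add.commute)

lemma act_diff: "act g (v - w) = act g v - act g w"
  using act_add[of g v "- w"] by (simp add: act_uminus)

lemma act_sum: "act g (sum f A) = (\<Sum>i\<in>A. act g (f i))"
  by (induction A rule: infinite_finite_induct) (simp_all add: act_add)

lemma sum_V: "(\<And>i. i \<in> A \<Longrightarrow> f i \<in> V) \<Longrightarrow> sum f A \<in> V"
  by (induction A rule: infinite_finite_induct) simp_all

lemma nmul_V [simp]: "v \<in> V \<Longrightarrow> nmul n v \<in> V"
  by (simp add: nmul_def sum_V)

lemma act_nmul: "act g (nmul n v) = nmul n (act g v)"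
  by (simp add: nmul_def act_sum)

lemma act_inv_cancel [simp]:
  "\<lbrakk>g \<in> carrier G; v \<in> V\<rbrakk> \<Longrightarrow> act (inv g) (act g v) = v"
  "\<lbrakk>g \<in> carrier G; v \<in> V\<rbrakk> \<Longrightarrow> act g (act (inv g) v) = v"
  by (simp_all add: act_mult[symmetric])

section \<open>The split extension of \<open>V\<close> by \<open>G\<close>\<close>

definition sdp :: "('v \<times> 'a) monoid" where
  "sdp = \<lparr>carrier = V \<times> carrier G,
          monoid.mult = (\<lambda>(v, g) (w, h). (v + act g w, g \<otimes> h)), one = (0, \<one>)\<rparr>"

lemma sdp_simps [simp]:
  "carrier sdp = V \<times> carrier G"
  "(v, g) \<otimes>\<^bsub>sdp\<^esub> (w, h) = (v + act g w, g \<otimes> h)"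
  "\<one>\<^bsub>sdp\<^esub> = (0, \<one>)"
  by (simp_all add: sdp_def)

lemma group_sdp: "group sdp"
proof (rule groupI)
  fix x assume "x \<in> carrier sdp"
  then show "\<exists>y\<in>carrier sdp. y \<otimes>\<^bsub>sdp\<^esub> x = \<one>\<^bsub>sdp\<^esub>"
    by (intro bexI[of _ "(- act (inv (snd x)) (fst x), inv (snd x))"]) (auto simp: mem_Times_iff sdp_def case_prod_beta)
qed (auto simp: act_add act_mult m_assoc add.assoc)

lemma sdp_inv: "\<lbrakk>v \<in> V; g \<in> carrier G\<rbrakk> \<Longrightarrow> inv\<^bsub>sdp\<^esub> (v, g) = (- act (inv g) v, inv g)"
  by (rule group.inv_equality[OF group_sdp]) auto

text \<open>The norm \<open>1 + g + ... + g^(n-1)\<close> applied to \<open>v\<close>. It is the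
  first component of the \<open>n\<close>-th power of \<open>(v, g)\<close>, so orders in the
  extension are read off from it.\<close>

definition norm_sum :: "nat \<Rightarrow> 'a \<Rightarrow> 'v \<Rightarrow> 'v" where
  "norm_sum n g v = (\<Sum>i<n. act (g [^] i) v)"

lemma norm_sum_V [simp]: "\<lbrakk>g \<in> carrier G; v \<in> V\<rbrakk> \<Longrightarrow> norm_sum n g v \<in> V"
  by (simp add: norm_sum_def sum_V)

lemma sdp_pow:
  assumes "v \<in> V" "g \<in> carrier G"
  shows "(v, g) [^]\<^bsub>sdp\<^esub> n = (norm_sum n g v, g [^] n)"
  by (induction n) (use assms in \<open>simp_all add: norm_sum_def\<close>)

lemma norm_sum_one: "v \<in> V \<Longrightarrow> norm_sum n \<one> v = nmul n v"
  by (simp add: norm_sum_def nmul_def)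

lemma norm_sum_diff: "norm_sum n g (v - w) = norm_sum n g v - norm_sum n g w"
  by (simp add: norm_sum_def act_diff sum_subtractf)

text \<open>The geometric sum \<open>(1 + g + ... + g^(n-1)) (g - 1) = g^n - 1\<close>. Hence
  attaching the vector \<open>g v - v\<close> to \<open>g\<close> preserves a relation
  \<open>g^n = 1\<close>.\<close>

lemma norm_sum_telescope:
  assumes "v \<in> V" "g \<in> carrier G"
  shows "norm_sum n g (act g v - v) = act (g [^] n) v - v"
proof (induction n)
  case (Suc n)
  have "act (g [^] Suc n) v = act (g [^] n) (act g v)"
    using assms by (simp add: act_mult)
  then show ?case using Suc by (simp add: norm_sum_def act_diff)
qed (use assms in \<open>simp add: norm_sum_def\<close>)

lemma norm_sum_fixed:
  assumes "v \<in> V" "g \<in> carrier G" "g [^] n = \<one>"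
  shows "act g (norm_sum n g v) = norm_sum n g v"
proof -
  have "act g (norm_sum n g v) - norm_sum n g v = norm_sum n g (act g v - v)"
    using assms
    by (simp add: norm_sum_def act_sum act_diff sum_subtractf act_mult[symmetric] nat_pow_Suc2[symmetric])
  also have "\<dots> = 0" using assms by (simp add: norm_sum_telescope)
  finally show ?thesis by simp
qed

lemma norm_sum_of_fixed:
  assumes "v \<in> V" "g \<in> carrier G" "act g v = v"
  shows "norm_sum n g v = nmul n v"
proof -
  have "act (g [^] i) v = v" for i :: nat
    by (induction i) (use assms in \<open>simp_all add: act_mult\<close>)
  then show ?thesis by (simp add: norm_sum_def nmul_def)
qed

lemma snd_sdp_hom: "group_hom sdp G snd"
  by (rule group_hom.intro[OF group_sdp is_group]) (auto simp: group_hom_axioms_def hom_def)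

end

lemma (in group) inv_cancel_left:
  "\<lbrakk>x \<in> carrier G; y \<in> carrier G\<rbrakk> \<Longrightarrow> inv x \<otimes> (x \<otimes> y) = y"
  "\<lbrakk>x \<in> carrier G; y \<in> carrier G\<rbrakk> \<Longrightarrow> x \<otimes> (inv x \<otimes> y) = y"
  by (simp_all add: m_assoc[symmetric])

context gmod
begin

section \<open>Fixed points and derivations when the group order is invertible on
  \<open>V\<close>\<close>

definition fixed_pts :: "'a set \<Rightarrow> 'v set" where
  "fixed_pts C = {v \<in> V. \<forall>c\<in>C. act c v = v}"

text \<open>Absence of \<open>n\<close>-torsion makes multiplication by \<open>n\<close> injective,
  and an injective self-map of a finite set is onto. This is what permits averaging over a
  group.\<close>

lemma nmul_surj:
  assumes "finite V" "\<And>v. \<lbrakk>v \<in> V; nmul n v = 0\<rbrakk> \<Longrightarrow> v = 0" "v \<in> V"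
  obtains u where "u \<in> V" "nmul n u = v"
proof -
  have "inj_on (nmul n) V"
  proof (rule inj_onI)
    fix u w assume "u \<in> V" "w \<in> V" "nmul n u = nmul n w"
    then have "u - w = 0" by (rule_tac assms(2)) (simp_all add: nmul_diff_right)
    then show "u = w" by simp
  qed
  moreover have "nmul n ` V \<subseteq> V" by auto
  ultimately have "nmul n ` V = V"
    using assms(1) by (simp add: endo_inj_surj)
  then obtain u where "u \<in> V" "nmul n u = v" using assms(3) by (metis imageE)
  then show ?thesis by (rule that)
qed

text \<open>The vector \<open>w = g v - v\<close> is fixed by \<open>g\<close>, so its norm of
  length \<open>|G|\<close> is \<open>|G| w\<close>; telescoping makes the same norm equal to
  \<open>g^|G| v - v = 0\<close>.\<close>

lemma unipotent_imp_fixed: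
  assumes "finite (carrier G)" "g \<in> carrier G" "v \<in> V"
    and "\<And>v. \<lbrakk>v \<in> V; nmul (order G) v = 0\<rbrakk> \<Longrightarrow> v = 0"
    and "act g (act g v - v) = act g v - v"
  shows "act g v = v"
proof -
  have "nmul (order G) (act g v - v) = norm_sum (order G) g (act g v - v)"
    using assms(2,3,5) by (simp add: norm_sum_of_fixed)
  also have "\<dots> = act (g [^] order G) v - v"
    using assms(2,3) by (simp add: norm_sum_telescope)
  also have "\<dots> = 0"
    using assms(1-3) by (simp add: pow_order_eq_1)
  finally have "act g v - v = 0" using assms(2,3) by (rule_tac assms(4)) simp_all
  then show ?thesis by simp
qed

text \<open>Vanishing of first cohomology by averaging: summing the rule for \<open>f (g h)\<close>
  over \<open>h\<close> gives \<open>|G| f g = D - g D\<close>, where \<open>D\<close> is the sum of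
  all values of \<open>f\<close>; the witness is \<open>b = - D / |G|\<close>.\<close>

lemma derivation_principal:
  assumes fin: "finite (carrier G)" "finite V"
    and tf: "\<And>v. \<lbrakk>v \<in> V; nmul (order G) v = 0\<rbrakk> \<Longrightarrow> v = 0"
    and fV: "\<And>g. g \<in> carrier G \<Longrightarrow> f g \<in> V"
    and f: "\<And>g h. \<lbrakk>g \<in> carrier G; h \<in> carrier G\<rbrakk> \<Longrightarrow> f (g \<otimes> h) = f g + act g (f h)"
  obtains b where "b \<in> V" "\<And>g. g \<in> carrier G \<Longrightarrow> f g = act g b - b"
proof -
  define D where "D = (\<Sum>h\<in>carrier G. f h)"
  have D: "D \<in> V" by (simp add: D_def sum_V fV)
  obtain b where b: "b \<in> V" "nmul (order G) b = - D"
    using nmul_surj[OF fin(2) tf uminus_V[OF D]] by blast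
  have "f g = act g b - b" if g: "g \<in> carrier G" for g
  proof -
    have "D = (\<Sum>h\<in>carrier G. f (g \<otimes> h))"
      unfolding D_def
      by (rule sum.reindex_bij_witness[where i = "\<lambda>h. g \<otimes> h" and j = "\<lambda>h. inv g \<otimes> h"])
        (use g in \<open>auto simp: inv_cancel_left\<close>)
    also have "\<dots> = nmul (order G) (f g) + act g D"
      using g fin by (simp add: f sum.distrib sum_const_nmul order_def D_def act_sum)
    finally have "nmul (order G) (f g) = D - act g D" by (simp add: eq_diff_eq)
    then have "nmul (order G) (f g - (act g b - b)) = 0"
      using b by (simp add: nmul_diff_right act_nmul[symmetric] act_uminus)
    then have "f g - (act g b - b) = 0"
      using g b fV by (rule_tac tf) simp_all
    then show ?thesis by simp
  qed
  with b that show thesis by blast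
qed

text \<open>If \<open>u\<close> acts as \<open>t\<close> and \<open>n\<close> maps to \<open>(v, \<one>)\<close>, then \<open>[u, [u, n]]\<close> maps to \<open>((t - 1)\<^sup>2 v, \<one>)\<close>;
  since \<open>t\<close> has finite order, this vanishes only if \<open>t v = v\<close>.\<close>

lemma derived_subset_kernel_imp_principal:
  assumes fin: "finite (carrier G)" "finite V"
    and tf: "\<And>v. \<lbrakk>v \<in> V; nmul (order G) v = 0\<rbrakk> \<Longrightarrow> v = 0"
    and hom: "group_hom T sdp \<phi>"
    and surj: "snd ` \<phi> ` carrier T = carrier G"
    and fixS: "fixed_pts ((derived G ^^ k) (carrier G)) = {0}"
    and ker: "(derived T ^^ Suc k) (carrier T) \<subseteq> kernel T sdp \<phi>"
  obtains b where "b \<in> V" "\<And>t. t \<in> carrier T \<Longrightarrow> fst (\<phi> t) = act (snd (\<phi> t)) b - b"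
proof -
  interpret \<phi>: group_hom T sdp \<phi> by fact
  interpret \<pi>: group_hom T G "snd \<circ> \<phi>"
    by (rule group_hom.intro[OF \<phi>.G.is_group is_group])
      (use Group.hom_compose[OF \<phi>.homh group_hom.homh[OF snd_sdp_hom]] in \<open>simp add: group_hom_axioms_def\<close>)
  define A where "A = (derived T ^^ k) (carrier T)"
  have A: "A \<lhd> T"
    unfolding A_def by (induction k) (auto simp: \<phi>.G.normal_self \<phi>.G.derived_is_normal)
  interpret A: normal A T by fact
  have imA: "(derived G ^^ k) (carrier G) = (snd \<circ> \<phi>) ` A"
    unfolding A_def using \<pi>.exp_of_derived_img[of "carrier T" k] surj by (simp add: image_comp)
  have closed: "fst (\<phi> t) \<in> V" "snd (\<phi> t) \<in> carrier G" if "t \<in> carrier T" for t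
    using \<phi>.hom_closed[OF that] by (auto simp: mem_Times_iff)
  have mult: "\<phi> (s \<otimes>\<^bsub>T\<^esub> t) = (fst (\<phi> s) + act (snd (\<phi> s)) (fst (\<phi> t)), snd (\<phi> s) \<otimes> snd (\<phi> t))"
    if "s \<in> carrier T" "t \<in> carrier T" for s t
    using that by (simp add: \<phi>.hom_mult sdp_def case_prod_beta)
  \<comment> \<open>By \<open>ker\<close>, commutators of elements of \<open>A\<close> are mapped to
    the identity, so the images of \<open>A\<close> commute. This is applied to \<open>u\<close> and
    the commutator \<open>[u, n]\<close>.\<close>
  have comm: "\<phi> (s \<otimes>\<^bsub>T\<^esub> t) = \<phi> (t \<otimes>\<^bsub>T\<^esub> s)" if "s \<in> A" "t \<in> A" for s t
  proof -
    note c = that[THEN A.mem_carrier]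
    have "s \<otimes>\<^bsub>T\<^esub> t \<otimes>\<^bsub>T\<^esub> inv\<^bsub>T\<^esub> s \<otimes>\<^bsub>T\<^esub> inv\<^bsub>T\<^esub> t \<in> derived T A"
      using that unfolding derived_def by (blast intro: generate.incl)
    then have "s \<otimes>\<^bsub>T\<^esub> t \<otimes>\<^bsub>T\<^esub> inv\<^bsub>T\<^esub> s \<otimes>\<^bsub>T\<^esub> inv\<^bsub>T\<^esub> t \<in> kernel T sdp \<phi>"
      using ker by (auto simp: A_def)
    then have "\<phi> (s \<otimes>\<^bsub>T\<^esub> t \<otimes>\<^bsub>T\<^esub> inv\<^bsub>T\<^esub> s \<otimes>\<^bsub>T\<^esub> inv\<^bsub>T\<^esub> t) = \<one>\<^bsub>sdp\<^esub>"
      by (simp add: kernel_def)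
    then have "\<phi> (s \<otimes>\<^bsub>T\<^esub> t \<otimes>\<^bsub>T\<^esub> inv\<^bsub>T\<^esub> s \<otimes>\<^bsub>T\<^esub> inv\<^bsub>T\<^esub> t \<otimes>\<^bsub>T\<^esub> (t \<otimes>\<^bsub>T\<^esub> s)) = \<phi> (t \<otimes>\<^bsub>T\<^esub> s)"
      using c \<phi>.hom_mult[of "s \<otimes>\<^bsub>T\<^esub> t \<otimes>\<^bsub>T\<^esub> inv\<^bsub>T\<^esub> s \<otimes>\<^bsub>T\<^esub> inv\<^bsub>T\<^esub> t" "t \<otimes>\<^bsub>T\<^esub> s"]
      by (simp del: sdp_simps)
    then show ?thesis
      using c by (simp add: \<phi>.G.m_assoc \<phi>.G.inv_cancel_left del: sdp_simps)
  qed
  have triv: "fst (\<phi> n) = 0" if n: "n \<in> carrier T" "snd (\<phi> n) = \<one>" for n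
  proof -
    have "act (snd (\<phi> u)) (fst (\<phi> n)) = fst (\<phi> n)" if u: "u \<in> A" for u
    proof (rule unipotent_imp_fixed)
      note uc = A.mem_carrier[OF u]
      \<comment> \<open>The commutator \<open>[u, n]\<close> lies in \<open>A\<close> by normality,
        and its image is the pure vector \<open>(t - 1) v\<close>, with \<open>t\<close> the action
        of \<open>u\<close> and \<open>v\<close> the first component of
        \<open>\<phi> n\<close>.\<close>
      define c where "c = u \<otimes>\<^bsub>T\<^esub> (n \<otimes>\<^bsub>T\<^esub> inv\<^bsub>T\<^esub> u \<otimes>\<^bsub>T\<^esub> inv\<^bsub>T\<^esub> n)"
      have cA: "c \<in> A"
        unfolding c_def using u n by (intro A.m_closed A.inv_op_closed2) auto
      note cc = A.mem_carrier[OF cA]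
      have "c \<otimes>\<^bsub>T\<^esub> (n \<otimes>\<^bsub>T\<^esub> u) = u \<otimes>\<^bsub>T\<^esub> n"
        using uc n by (simp add: c_def \<phi>.G.m_assoc \<phi>.G.inv_cancel_left)
      then have "\<phi> (c \<otimes>\<^bsub>T\<^esub> (n \<otimes>\<^bsub>T\<^esub> u)) = \<phi> (u \<otimes>\<^bsub>T\<^esub> n)" by simp
      then have eq: "fst (\<phi> c) + act (snd (\<phi> c)) (fst (\<phi> n) + act \<one> (fst (\<phi> u)))
          = fst (\<phi> u) + act (snd (\<phi> u)) (fst (\<phi> n))"
        "snd (\<phi> c) \<otimes> (\<one> \<otimes> snd (\<phi> u)) = snd (\<phi> u) \<otimes> \<one>"
        using uc n cc by (simp_all add: mult del: sdp_simps \<phi>.hom_mult)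
      from eq(2) have c1: "snd (\<phi> c) = \<one>"
        using closed uc cc by simp
      with eq(1) have cfst: "fst (\<phi> c) = act (snd (\<phi> u)) (fst (\<phi> n)) - fst (\<phi> n)"
        using closed[OF uc] closed[OF n(1)] by (simp add: algebra_simps)
      have "\<phi> (u \<otimes>\<^bsub>T\<^esub> c) = \<phi> (c \<otimes>\<^bsub>T\<^esub> u)"
        using comm[OF u cA] .
      then have "fst (\<phi> u) + act (snd (\<phi> u)) (fst (\<phi> c)) = fst (\<phi> c) + act \<one> (fst (\<phi> u))"
        unfolding mult[OF uc cc] mult[OF cc uc] c1 by simp
      then have "act (snd (\<phi> u)) (fst (\<phi> c)) = fst (\<phi> c)"
        using closed[OF uc] by (metis act_one add.commute add_left_imp_eq)
      then show "act (snd (\<phi> u)) (act (snd (\<phi> u)) (fst (\<phi> n)) - fst (\<phi> n))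
          = act (snd (\<phi> u)) (fst (\<phi> n)) - fst (\<phi> n)"
        by (simp only: cfst)
      show "v = 0" if "v \<in> V" "nmul (order G) v = 0" for v
        by (rule tf) fact+
    qed (use fin(1) closed[OF A.mem_carrier[OF u]] closed[OF n(1)] in simp_all)
    then have "fst (\<phi> n) \<in> fixed_pts ((derived G ^^ k) (carrier G))"
      using closed n by (auto simp: fixed_pts_def imA)
    then show ?thesis using fixS by simp
  qed
  \<comment> \<open>The derivation descends from \<open>T\<close> to \<open>G\<close> through an
    arbitrary preimage; \<open>triv\<close> makes the choice irrelevant, since two preimages differ
    by an element with trivial image in \<open>G\<close>.\<close>
  define f where "f g = fst (\<phi> (SOME t. t \<in> carrier T \<and> snd (\<phi> t) = g))" for g
  have f_eq: "f (snd (\<phi> t)) = fst (\<phi> t)" if t: "t \<in> carrier T" for t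
  proof -
    define s where "s = (SOME s. s \<in> carrier T \<and> snd (\<phi> s) = snd (\<phi> t))"
    have s: "s \<in> carrier T" "snd (\<phi> s) = snd (\<phi> t)"
      using someI[of "\<lambda>s. s \<in> carrier T \<and> snd (\<phi> s) = snd (\<phi> t)" t] t by (auto simp: s_def)
    let ?n = "s \<otimes>\<^bsub>T\<^esub> inv\<^bsub>T\<^esub> t"
    have "snd (\<phi> ?n) = \<one>"
      using s t \<pi>.hom_mult[of s "inv\<^bsub>T\<^esub> t"] \<pi>.hom_inv[of t] closed by simp
    moreover from this have "fst (\<phi> ?n) = 0" using s t by (intro triv) auto
    ultimately have "\<phi> ?n = \<one>\<^bsub>sdp\<^esub>" by (simp add: prod_eq_iff)
    then have "\<phi> (?n \<otimes>\<^bsub>T\<^esub> t) = \<phi> t" using s t by (simp del: sdp_simps add: \<phi>.hom_mult)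
    then show ?thesis using s t by (simp add: f_def s_def[symmetric] \<phi>.G.m_assoc)
  qed
  have rep: "\<exists>t\<in>carrier T. snd (\<phi> t) = g" if "g \<in> carrier G" for g
    using surj that by (metis (no_types, lifting) imageE)
  obtain b where b: "b \<in> V" "\<And>g. g \<in> carrier G \<Longrightarrow> f g = act g b - b"
  proof (rule derivation_principal[OF fin, of f])
    show "f g \<in> V" if "g \<in> carrier G" for g
      using rep[OF that] f_eq closed by metis
    show "f (g \<otimes> h) = f g + act g (f h)" if gh: "g \<in> carrier G" "h \<in> carrier G" for g h
    proof -
      obtain s t where "s \<in> carrier T" "snd (\<phi> s) = g" "t \<in> carrier T" "snd (\<phi> t) = h"
        using rep gh by metis
      then show ?thesis using f_eq[of "s \<otimes>\<^bsub>T\<^esub> t"] f_eq[of s] f_eq[of t]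
        by (simp add: mult del: sdp_simps \<phi>.hom_mult)
    qed
    show "v = 0" if "v \<in> V" "nmul (order G) v = 0" for v
      by (rule tf) fact+
  qed blast
  show thesis
  proof (rule that[OF b(1)])
    fix t assume "t \<in> carrier T"
    then show "fst (\<phi> t) = act (snd (\<phi> t)) b - b"
      using f_eq b(2) closed by metis
  qed
qed

text \<open>Think of a derivation with values \<open>(a - 1) s\<close> and \<open>0\<close> on the
  generators: the norm condition is the relation on their product, and the last property says that
  it is not principal. If every admissible \<open>s\<close> failed that property through some
  \<open>u\<close>, then \<open>s - u\<close> would be fixed by \<open>a\<close> and
  \<open>u\<close> by \<open>b\<close>, bounding the number of admissible \<open>s\<close> by
  \<open>|V^a| |V^b|\<close>. As these \<open>s\<close> form the kernel of an additive map from
  \<open>V\<close> into \<open>V^(ab)\<close>, this contradicts \<open>card\<close>.\<close>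

lemma exists_nonprincipal:
  assumes fin: "finite V"
    and a: "a \<in> carrier G" "b \<in> carrier G" and c: "(a \<otimes> b) [^] n = \<one>"
    and card: "card (fixed_pts {a}) * card (fixed_pts {b}) * card (fixed_pts {a \<otimes> b}) < card V"
  obtains s where "s \<in> V" "norm_sum n (a \<otimes> b) (act a s - s) = 0"
    "\<And>u. \<lbrakk>u \<in> V; act b u = u\<rbrakk> \<Longrightarrow> act a u - u \<noteq> act a s - s"
proof -
  define K where "K = {s \<in> V. norm_sum n (a \<otimes> b) (act a s - s) = 0}"
  have "\<exists>s\<in>K. \<forall>u. u \<in> V \<and> act b u = u \<longrightarrow> act a u - u \<noteq> act a s - s"
  proof (rule ccontr)
    assume neg: "\<not> ?thesis"
    have "K \<subseteq> (\<lambda>(u, w). u + w) ` (fixed_pts {a} \<times> fixed_pts {b})"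
    proof
      fix s assume s: "s \<in> K"
      then obtain u where "u \<in> V" "act b u = u" "act a u - u = act a s - s"
        using neg by blast
      then have "s - u \<in> fixed_pts {a}" "u \<in> fixed_pts {b}"
        using s by (auto simp: fixed_pts_def K_def act_diff algebra_simps)
      then show "s \<in> (\<lambda>(u, w). u + w) ` (fixed_pts {a} \<times> fixed_pts {b})"
        by (intro image_eqI[of _ _ "(s - u, u)"]) auto
    qed
    moreover have ff: "finite (fixed_pts C)" for C
      using fin by (simp add: fixed_pts_def)
    ultimately have "card K \<le> card (fixed_pts {a} \<times> fixed_pts {b})"
      by (meson card_image_le card_mono finite_SigmaI finite_imageI le_trans)
    then have cK: "card K \<le> card (fixed_pts {a}) * card (fixed_pts {b})" by (simp add: card_cartesian_product)
    define F where "F s = norm_sum n (a \<otimes> b) (act a s - s)" for s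
    \<comment> \<open>\<open>R\<close> picks a preimage under \<open>F\<close>, so \<open>s\<close>
      is recovered from \<open>F s\<close>, which is fixed by \<open>a \<otimes> b\<close>, and from
      \<open>s - R (F s)\<close>, which lies in the kernel \<open>K\<close>.\<close>
    define R where "R y = (SOME s. s \<in> V \<and> F s = y)" for y
    have R: "R (F s) \<in> V" "F (R (F s)) = F s" if "s \<in> V" for s
      using someI[of "\<lambda>t. t \<in> V \<and> F t = F s" s] that by (auto simp: R_def)
    have "inj_on (\<lambda>s. (F s, s - R (F s))) V"
      by (rule inj_onI) auto
    moreover have "(\<lambda>s. (F s, s - R (F s))) ` V \<subseteq> fixed_pts {a \<otimes> b} \<times> K"
    proof (rule image_subsetI)
      fix s assume s: "s \<in> V"
      have "F s \<in> fixed_pts {a \<otimes> b}"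
        using s a c by (simp add: F_def fixed_pts_def norm_sum_fixed)
      moreover have "F (s - R (F s)) = F s - F (R (F s))"
        by (simp add: F_def act_diff norm_sum_diff)
      ultimately show "(F s, s - R (F s)) \<in> fixed_pts {a \<otimes> b} \<times> K"
        using s R[OF s] by (simp add: K_def F_def)
    qed
    moreover have "finite (fixed_pts {a \<otimes> b} \<times> K)"
      using fin ff by (simp add: K_def)
    ultimately have "card V \<le> card (fixed_pts {a \<otimes> b} \<times> K)"
      by (rule card_inj_on_le)
    also have "\<dots> \<le> card (fixed_pts {a \<otimes> b}) * (card (fixed_pts {a}) * card (fixed_pts {b}))"
      using cK by (simp add: card_cartesian_product)
    finally show False using card by (simp add: mult_ac)
  qed
  then show thesis using that by (auto simp: K_def)
qed

text \<open>The kernel of the norm of \<open>S\<close>. For finite \<open>V\<close> on which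
  \<open>|S|\<close> is invertible it is the complement of the \<open>S\<close>-fixed
  points.\<close>

definition sum_zero :: "'a set \<Rightarrow> 'v set" where
  "sum_zero S = {v \<in> V. (\<Sum>s\<in>S. act s v) = 0}"

text \<open>Normality permits the substitution \<open>s g = g (g^-1 s g)\<close>, which permutes
  \<open>S\<close>.\<close>

lemma sum_conj:
  assumes "S \<lhd> G" "g \<in> carrier G" "v \<in> V"
  shows "(\<Sum>s\<in>S. act s (act g v)) = act g (\<Sum>s\<in>S. act s v)"
proof -
  interpret S: normal S G by fact
  have "(\<Sum>s\<in>S. act s (act g v)) = (\<Sum>s\<in>S. act (g \<otimes> s) v)"
    by (rule sum.reindex_bij_witness[where i = "\<lambda>s. g \<otimes> s \<otimes> inv g" and j = "\<lambda>s. inv g \<otimes> s \<otimes> g"])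
      (use assms S.mem_carrier S.inv_op_closed1 S.inv_op_closed2 in \<open>simp_all add: m_assoc
        inv_cancel_left act_mult[symmetric]\<close>)
  also have "\<dots> = act g (\<Sum>s\<in>S. act s v)"
    using assms S.mem_carrier by (simp add: act_sum act_mult)
  finally show ?thesis .
qed

lemma gmod_sum_zero:
  assumes "S \<lhd> G"
  shows "gmod G act (sum_zero S)"
proof
  interpret S: normal S G by fact
  fix g h v w
  show "v + w \<in> sum_zero S" if "v \<in> sum_zero S" "w \<in> sum_zero S"
    using that by (simp add: sum_zero_def act_add sum.distrib)
  show "- v \<in> sum_zero S" if "v \<in> sum_zero S"
    using that by (simp add: sum_zero_def act_uminus sum_negf)
  show "act g v \<in> sum_zero S" if "g \<in> carrier G" "v \<in> sum_zero S"
    using that by (simp add: sum_zero_def sum_conj[OF assms])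
qed (auto simp: sum_zero_def act_add act_mult)

text \<open>Averaging over \<open>S\<close> projects \<open>V\<close> onto its
  \<open>S\<close>-fixed part with kernel \<open>sum_zero S\<close>. The projection commutes with
  \<open>C\<close> because \<open>S\<close> is normal, so the splitting restricts to the
  \<open>C\<close>-fixed points and their numbers multiply.\<close>

lemma card_fixed_pts_split:
  assumes S: "S \<lhd> G" and C: "C \<subseteq> carrier G" and fin: "finite V" "finite S"
    and tf: "\<And>v. \<lbrakk>v \<in> V; nmul (card S) v = 0\<rbrakk> \<Longrightarrow> v = 0"
  shows "card (fixed_pts C) = card (fixed_pts (S \<union> C)) * card (fixed_pts C \<inter> sum_zero S)"
proof -
  interpret S: normal S G by fact
  have sum_fix: "(\<Sum>s\<in>S. act s v) = nmul (card S) v" if "v \<in> fixed_pts S" for v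
    using that fin by (simp add: fixed_pts_def sum_const_nmul)
  have "bij_betw (\<lambda>(u, w). u + w) (fixed_pts (S \<union> C) \<times> (fixed_pts C \<inter> sum_zero S)) (fixed_pts C)"
    unfolding bij_betw_def
  proof
    show "inj_on (\<lambda>(u, w). u + w) (fixed_pts (S \<union> C) \<times> (fixed_pts C \<inter> sum_zero S))"
    proof (rule inj_onI, clarify)
      fix u w u' w'
      assume *: "u \<in> fixed_pts (S \<union> C)" "u' \<in> fixed_pts (S \<union> C)" "w \<in> sum_zero S" "w' \<in> sum_zero S"
        and eq: "u + w = u' + w'"
      have "u - u' \<in> fixed_pts S" using * by (auto simp: fixed_pts_def act_diff)
      then have "nmul (card S) (u - u') = (\<Sum>s\<in>S. act s (u - u'))" by (simp add: sum_fix)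
      also have uw: "u - u' = w' - w" using eq by (simp add: algebra_simps)
      also have "(\<Sum>s\<in>S. act s (w' - w)) = 0"
        using * by (simp add: sum_zero_def act_diff sum_subtractf)
      finally have "nmul (card S) (u - u') = 0" by (simp only: uw)
      then have "u - u' = 0" using *(1,2)
        by (rule_tac tf) (auto simp: fixed_pts_def)
      then show "u = u' \<and> w = w'" using eq by simp
    qed
    show "(\<lambda>(u, w). u + w) ` (fixed_pts (S \<union> C) \<times> (fixed_pts C \<inter> sum_zero S)) = fixed_pts C"
    proof
      show "(\<lambda>(u, w). u + w) ` (fixed_pts (S \<union> C) \<times> (fixed_pts C \<inter> sum_zero S)) \<subseteq> fixed_pts C"
        by (auto simp: fixed_pts_def act_add)
      show "fixed_pts C \<subseteq> (\<lambda>(u, w). u + w) ` (fixed_pts (S \<union> C) \<times> (fixed_pts C \<inter> sum_zero S))"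
      proof
        fix v assume v: "v \<in> fixed_pts C"
        then have vV: "v \<in> V" by (simp add: fixed_pts_def)
        define D where "D = (\<Sum>s\<in>S. act s v)"
        have DV: "D \<in> V" using vV S.mem_carrier by (simp add: D_def sum_V)
        \<comment> \<open>\<open>u\<close> is the average of \<open>v\<close> over \<open>S\<close>.
          Division by \<open>|S|\<close> is unique, so \<open>u\<close> inherits every invariance of
          \<open>D\<close>.\<close>
        obtain u where u: "u \<in> V" "nmul (card S) u = D"
          using nmul_surj[OF fin(1) tf DV] by blast
        have fixed: "act g u = u" if g: "g \<in> carrier G" "act g D = D" for g
        proof -
          have "nmul (card S) (act g u - u) = 0"
            using g u by (simp add: nmul_diff_right act_nmul[symmetric])
          then have "act g u - u = 0" using g u by (rule_tac tf) simp_all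
          then show ?thesis by simp
        qed
        have "act t D = D" if t: "t \<in> S" for t
          unfolding D_def act_sum
          by (rule sum.reindex_bij_witness[where i = "\<lambda>s. inv t \<otimes> s" and j = "\<lambda>s. t \<otimes> s"])
            (use t vV S.mem_carrier in \<open>auto simp: inv_cancel_left act_mult\<close>)
        moreover have "act c D = D" if c: "c \<in> C" for c
          using v C c sum_conj[OF S, of c v] by (auto simp: D_def fixed_pts_def)
        ultimately have uf: "u \<in> fixed_pts (S \<union> C)"
          using u fixed C S.mem_carrier by (auto simp: fixed_pts_def)
        moreover have "v - u \<in> fixed_pts C" using v uf by (auto simp: fixed_pts_def act_diff)
        moreover have "v - u \<in> sum_zero S"
          using vV u sum_fix[of u] uf
          by (auto simp: sum_zero_def act_diff sum_subtractf D_def fixed_pts_def)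
        ultimately show "v \<in> (\<lambda>(u, w). u + w) ` (fixed_pts (S \<union> C) \<times> (fixed_pts C \<inter> sum_zero S))"
          by (intro image_eqI[of _ _ "(u, v - u)"]) auto
      qed
    qed
  qed
  then show ?thesis by (simp add: bij_betw_same_card[symmetric] card_cartesian_product)
qed

lemma fixed_pts_generate:
  assumes "C \<subseteq> carrier G"
  shows "fixed_pts (generate G C) = fixed_pts C"
proof
  show "fixed_pts (generate G C) \<subseteq> fixed_pts C"
    by (auto simp: fixed_pts_def intro: generate.incl)
  have "act g v = v" if v: "v \<in> fixed_pts C" and "g \<in> generate G C" for g v
    using that(2)
  proof (induction rule: generate.induct)
    case one
    then show ?case using v by (simp add: fixed_pts_def)
  next
    case (incl h)
    then show ?case using v by (simp add: fixed_pts_def)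
  next
    case (inv h)
    then have "act (inv h) (act h v) = v" using v inv assms by (intro act_inv_cancel) (auto simp: fixed_pts_def)
    moreover have "act h v = v" using v inv by (simp add: fixed_pts_def)
    ultimately show ?case by simp
  next
    case (eng g h)
    then show ?case using v generate_in_carrier[OF assms] by (simp add: fixed_pts_def act_mult)
  qed
  then show "fixed_pts C \<subseteq> fixed_pts (generate G C)" by (auto simp: fixed_pts_def)
qed

lemma fixed_pts_set_mult:
  assumes "subgroup S G" "subgroup C G"
  shows "fixed_pts (S <#> C) = fixed_pts (S \<union> C)"
proof
  interpret S: subgroup S G by fact
  interpret C: subgroup C G by fact
  have "s \<in> S <#> C" if "s \<in> S" for s
  proof -
    have "s \<otimes> \<one> \<in> S <#> C" using that C.one_closed unfolding set_mult_def by blast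
    then show ?thesis using S.mem_carrier[OF that] by simp
  qed
  moreover have "c \<in> S <#> C" if "c \<in> C" for c
  proof -
    have "\<one> \<otimes> c \<in> S <#> C" using that S.one_closed unfolding set_mult_def by blast
    then show ?thesis using C.mem_carrier[OF that] by simp
  qed
  ultimately show "fixed_pts (S <#> C) \<subseteq> fixed_pts (S \<union> C)" by (auto simp: fixed_pts_def)
  show "fixed_pts (S \<union> C) \<subseteq> fixed_pts (S <#> C)"
  proof
    fix v assume v: "v \<in> fixed_pts (S \<union> C)"
    have "act g v = v" if "g \<in> S <#> C" for g
    proof -
      from that obtain s c where "s \<in> S" "c \<in> C" "g = s \<otimes> c"
        unfolding set_mult_def by blast
      then show ?thesis using v S.mem_carrier C.mem_carrier by (simp add: act_mult fixed_pts_def)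
    qed
    then show "v \<in> fixed_pts (S <#> C)" using v by (simp add: fixed_pts_def)
  qed
qed

end

subsection \<open>Counting fixed points in the regular module\<close>

context group
begin

text \<open>The left regular action. The value \<open>0\<close> off the carrier makes equality of
  functions in \<open>funs M\<close> a matter of their values on the group.\<close>

definition translate :: "'a \<Rightarrow> ('a \<Rightarrow> 'v::ab_group_add) \<Rightarrow> 'a \<Rightarrow> 'v" where
  "translate g f = (\<lambda>k. if k \<in> carrier G then f (inv g \<otimes> k) else 0)"

definition funs :: "'v::ab_group_add set \<Rightarrow> ('a \<Rightarrow> 'v) set" where
  "funs M = {f. (\<forall>k\<in>carrier G. f k \<in> M) \<and> (\<forall>k. k \<notin> carrier G \<longrightarrow> f k = 0)}"

lemma gmod_funs:
  fixes M :: "'v::ab_group_add set"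
  assumes "0 \<in> M" "\<And>v w. \<lbrakk>v \<in> M; w \<in> M\<rbrakk> \<Longrightarrow> v + w \<in> M" "\<And>v. v \<in> M \<Longrightarrow> - v \<in> M"
  shows "gmod G translate (funs M)"
proof
  fix g h and v :: "'a \<Rightarrow> 'v"
  assume "g \<in> carrier G" "h \<in> carrier G" "v \<in> funs M"
  then show "translate (g \<otimes> h) v = translate g (translate h v)"
    by (auto simp: translate_def fun_eq_iff inv_mult_group m_assoc)
qed (use assms in \<open>auto simp: translate_def funs_def fun_eq_iff\<close>)

lemma finite_funs:
  assumes "finite (carrier G)" "finite M"
  shows "finite (funs M)"
proof -
  have "finite {f. (\<forall>k. (k \<in> carrier G \<longrightarrow> f k \<in> M) \<and> (k \<notin> carrier G \<longrightarrow> f k = 0))}"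
    using assms by (rule finite_set_of_finite_funs)
  moreover have "{f. (\<forall>k. (k \<in> carrier G \<longrightarrow> f k \<in> M) \<and> (k \<notin> carrier G \<longrightarrow> f k = 0))} = funs M"
    by (auto simp: funs_def)
  ultimately show ?thesis by simp
qed

text \<open>Invariance under left translation by \<open>C\<close> means being constant on the cosets
  \<open>C #> k\<close>, so \<open>\<Phi>\<close> matches these functions with arbitrary
  \<open>M\<close>-valued functions on the set of cosets.\<close>

lemma card_fixed_funs:
  fixes M :: "'v::ab_group_add set"
  assumes C: "subgroup C G" and fin: "finite (carrier G)"
  shows "card {f \<in> funs M. \<forall>c\<in>C. translate c f = f} = card M ^ card (rcosets C)"
proof -
  interpret C: subgroup C G by fact
  let ?F = "{f \<in> funs M. \<forall>c\<in>C. translate c f = f}"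
  define \<Phi> where "\<Phi> h = (\<lambda>k. if k \<in> carrier G then h (C #> k) else 0)" for h :: "'a set \<Rightarrow> 'v"
  have coset: "C #> (inv c \<otimes> k) = C #> k" if "c \<in> C" "k \<in> carrier G" for c k
    using that C.rcos_const[OF is_group, of "inv c"]
    by (metis C.m_inv_closed C.mem_carrier C.subset coset_mult_assoc)
  have "bij_betw \<Phi> (rcosets C \<rightarrow>\<^sub>E M) ?F"
    unfolding bij_betw_def
  proof
    show "inj_on \<Phi> (rcosets C \<rightarrow>\<^sub>E M)"
    proof (rule inj_onI)
      fix h h' assume h: "h \<in> rcosets C \<rightarrow>\<^sub>E M" "h' \<in> rcosets C \<rightarrow>\<^sub>E M" and eq: "\<Phi> h = \<Phi> h'"
      have "h R = h' R" if R: "R \<in> rcosets C" for R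
      proof -
        obtain k where "k \<in> carrier G" "R = C #> k" using R by (auto simp: RCOSETS_def)
        then show ?thesis using fun_cong[OF eq, of k] by (simp add: \<Phi>_def)
      qed
      then show "h = h'" using h by (rule_tac PiE_ext)
    qed
    show "\<Phi> ` (rcosets C \<rightarrow>\<^sub>E M) = ?F"
    proof
      show "\<Phi> ` (rcosets C \<rightarrow>\<^sub>E M) \<subseteq> ?F"
      proof (rule image_subsetI)
        fix h assume h: "h \<in> rcosets C \<rightarrow>\<^sub>E M"
        have "h (C #> k) \<in> M" if "k \<in> carrier G" for k
          using h rcosetsI[OF C.subset that] by auto
        then have "\<Phi> h \<in> funs M" by (auto simp: \<Phi>_def funs_def)
        moreover have "translate c (\<Phi> h) = \<Phi> h" if "c \<in> C" for c
          using that by (auto simp: translate_def \<Phi>_def coset fun_eq_iff)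
        ultimately show "\<Phi> h \<in> ?F" by blast
      qed
      show "?F \<subseteq> \<Phi> ` (rcosets C \<rightarrow>\<^sub>E M)"
      proof
        fix f assume f: "f \<in> ?F"
        define h where "h = (\<lambda>R\<in>rcosets C. f (SOME k. k \<in> R))"
        have fh: "h (C #> k) = f k" if k: "k \<in> carrier G" for k
        proof -
          define k' where "k' = (SOME k'. k' \<in> C #> k)"
          have "k' \<in> C #> k"
            unfolding k'_def by (rule someI[of _ k]) (rule rcos_self[OF k C])
          then obtain c where c: "c \<in> C" "k' = c \<otimes> k" by (auto simp: r_coset_def)
          have "f k' = translate c f k'" using f c by auto
          also have "\<dots> = f k" using c k by (simp add: translate_def inv_cancel_left)
          finally show ?thesis using rcosetsI[OF C.subset k] by (simp add: h_def k'_def)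
        qed
        have "h \<in> rcosets C \<rightarrow>\<^sub>E M"
        proof (rule PiE_I)
          fix R assume "R \<in> rcosets C"
          then obtain k where "k \<in> carrier G" "R = C #> k" by (auto simp: RCOSETS_def)
          then show "h R \<in> M" using fh f by (simp add: funs_def)
        qed (simp add: h_def)
        moreover have "f = \<Phi> h"
          using f fh by (auto simp: \<Phi>_def fun_eq_iff funs_def)
        ultimately show "f \<in> \<Phi> ` (rcosets C \<rightarrow>\<^sub>E M)" by blast
      qed
    qed
  qed
  then have "card ?F = card (rcosets C \<rightarrow>\<^sub>E M)" by (simp add: bij_betw_same_card)
  also have "\<dots> = card M ^ card (rcosets C)"
  proof (rule card_funcsetE)
    show "finite (rcosets C)"
      using fin finite_subset[OF rcosets_subset_PowG[OF C]] by simp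
  qed
  finally show ?thesis .
qed

lemma gmod_funs_torsion: "gmod G translate (funs (torsion l))"
  by (rule gmod_funs) (simp_all add: torsion_closed)

lemma funs_torsion_free:
  assumes "coprime l n" "v \<in> funs (torsion l)" "nmul n v = 0"
  shows "v = 0"
proof
  fix k
  have "nmul n (v k) = 0" using assms(3) by (simp add: nmul_fun[symmetric])
  then show "v k = 0 k"
    using assms(2) nmul_coprime_eq_0[OF assms(1), of "v k"]
    by (cases "k \<in> carrier G") (auto simp: funs_def torsion_def)
qed

lemma card_generate_ord:
  assumes "finite (carrier G)" "a \<in> carrier G"
  shows "card (rcosets (generate G {a})) * ord a = order G"
  using lagrange_finite[OF assms(1) generate_is_subgroup, of "{a}"] assms
  by (simp add: generate_pow_card)

text \<open>The product map from \<open>S \<times> generate G {a}\<close> bounds the order of the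
  subgroup by \<open>|S| ord a\<close>; Lagrange turns this into a lower bound for the number of
  cosets.\<close>

lemma card_rcosets_mult_ge:
  assumes fin: "finite (carrier G)" and S: "S \<lhd> G" and a: "a \<in> carrier G"
  shows "order G \<le> card (rcosets (S <#> generate G {a})) * (card S * ord a)"
    and "subgroup (S <#> generate G {a}) G"
proof -
  interpret S: normal S G by fact
  have g: "subgroup (generate G {a}) G" using a by (intro generate_is_subgroup) simp
  show sub: "subgroup (S <#> generate G {a}) G"
    by (rule mult_norm_subgroup[OF S g])
  have "S <#> generate G {a} = (\<lambda>(s, c). s \<otimes> c) ` (S \<times> generate G {a})"
    by (auto simp: set_mult_def)
  moreover have "finite (S \<times> generate G {a})"
    using fin S.subset subgroup.subset[OF g] by (metis finite_SigmaI finite_subset)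
  ultimately have "card (S <#> generate G {a}) \<le> card (S \<times> generate G {a})"
    by (simp add: card_image_le)
  also have "\<dots> = card S * ord a"
    using generate_pow_card[OF a] by (simp add: card_cartesian_product)
  finally have "card (S <#> generate G {a}) \<le> card S * ord a" .
  then show "order G \<le> card (rcosets (S <#> generate G {a})) * (card S * ord a)"
    using lagrange_finite[OF fin sub] by (metis mult_le_mono2)
qed

text \<open>With \<open>V = V\<^sup>S \<oplus> V\<^sub>0\<close>, the dimension of the \<open>c\<close>-fixed points of \<open>V\<^sub>0\<close> is the number of
  \<open>\<langle>c\<rangle>\<close>-orbits minus the number of \<open>S\<langle>c\<rangle>\<close>-orbits on \<open>G\<close>, hence at most
  \<open>(1 - 1 / |S|) |G| / ord c\<close>, with equality for \<open>c = \<one>\<close>.\<close>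

lemma card_fixed_sum_zero_less:
  fixes l :: nat
  defines "M \<equiv> torsion l :: 'v::ab_group_add set"
  defines "V0 \<equiv> gmod.sum_zero translate (funs M)"
  assumes fin: "finite (carrier G)" "finite M" and M2: "2 \<le> card M" and cop: "coprime l (order G)"
    and S: "S \<lhd> G" "S \<noteq> {\<one>}"
    and ab: "a \<in> carrier G" "b \<in> carrier G" "c \<in> carrier G"
    and hyp: "1 / real (ord a) + 1 / real (ord b) + 1 / real (ord c) < 1"
  shows "card (gmod.fixed_pts translate (V0 S) {a}) * card (gmod.fixed_pts translate (V0 S) {b}) *
      card (gmod.fixed_pts translate (V0 S) {c}) < card (V0 S)"
proof -
  interpret F: gmod G translate "funs M" unfolding M_def by (rule gmod_funs_torsion)
  interpret S: normal S G by fact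
  interpret Z: gmod G translate "F.sum_zero S" by (rule F.gmod_sum_zero) fact
  have finS: "finite S" using S.subset fin(1) by (rule finite_subset)
  have S2: "2 \<le> card S"
  proof -
    have "card S \<noteq> 1" using S(2) S.one_closed by (metis card_1_singletonE singletonD)
    moreover have "card S \<noteq> 0" using finS S.one_closed by (metis card_0_eq empty_iff)
    ultimately show ?thesis by simp
  qed
  have "card S dvd order G" using lagrange_finite[OF fin(1) S.subgroup_axioms] by (metis dvd_triv_right)
  then have copS: "coprime l (card S)" using cop by (meson coprime_divisors dvd_refl)
  define m where "m = card M"
  define n where "n = order G"
  \<comment> \<open>The exponent of \<open>m\<close> in the number of functions fixed by both
    \<open>S\<close> and \<open>D\<close>. Taking \<open>D = {}\<close> gives the trivial subgroup,
    hence the size of the whole module.\<close>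
  define k where "k D = card (rcosets (S <#> generate G D))" for D
  define z where "z D = card (Z.fixed_pts D)" for D
  have split: "m ^ card (rcosets (generate G D)) = m ^ k D * z D" if D: "D \<subseteq> carrier G" "subgroup (S <#> generate G D) G" for D
  proof -
    have g: "subgroup (generate G D) G" by (rule generate_is_subgroup[OF D(1)])
    have "m ^ card (rcosets (generate G D)) = card (F.fixed_pts (generate G D))"
      unfolding F.fixed_pts_def m_def by (rule card_fixed_funs[OF g fin(1), symmetric])
    also have "\<dots> = card (F.fixed_pts D)" by (simp only: F.fixed_pts_generate[OF D(1)])
    also have "\<dots> = card (F.fixed_pts (S \<union> D)) * card (F.fixed_pts D \<inter> F.sum_zero S)"
    proof (rule F.card_fixed_pts_split[OF S(1) D(1) finite_funs[OF fin] finS])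
      show "v = 0" if "v \<in> funs M" "nmul (card S) v = 0" for v
        using that funs_torsion_free[OF copS] by (simp add: M_def)
    qed
    also have "F.fixed_pts (S \<union> D) = F.fixed_pts (S \<union> generate G D)"
      using F.fixed_pts_generate[OF D(1)] by (auto simp: F.fixed_pts_def)
    also have "\<dots> = F.fixed_pts (S <#> generate G D)"
      by (rule F.fixed_pts_set_mult[OF S.subgroup_axioms g, symmetric])
    also have "card \<dots> = m ^ k D"
      unfolding F.fixed_pts_def m_def k_def by (rule card_fixed_funs[OF D(2) fin(1)])
    also have "F.fixed_pts D \<inter> F.sum_zero S = Z.fixed_pts D"
      unfolding F.fixed_pts_def Z.fixed_pts_def by (auto simp: F.sum_zero_def)
    finally show ?thesis by (simp add: z_def)
  qed
  have n0: "n > 0" using fin(1) by (simp add: n_def order_gt_0_iff_finite)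
  have p0: "ord x > 0" if "x \<in> carrier G" for x
    using ord_ge_1[OF fin(1) that] by simp
  define o' where "o' x = card (rcosets (generate G {x}))" for x
  have o: "real (o' x) = n / ord x" if "x \<in> carrier G" for x
    using card_generate_ord[OF fin(1) that] p0[OF that]
    by (simp add: o'_def n_def field_simps flip: of_nat_mult)
  have kx: "real (k {x}) \<ge> n / (card S * ord x)" if x: "x \<in> carrier G" for x
  proof -
    have "real n \<le> real (k {x}) * (card S * ord x)"
      using card_rcosets_mult_ge(1)[OF fin(1) S(1) x]
      unfolding n_def k_def by (simp flip: of_nat_mult)
    then show ?thesis using p0[OF x] S2 by (simp add: field_simps)
  qed
  have eq: "m ^ o' x = m ^ k {x} * z {x}" if "x \<in> carrier G" for x
    using split[of "{x}"] card_rcosets_mult_ge(2)[OF fin(1) S(1) that] that by (simp add: o'_def)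
  have k1: "real (k {}) = n / card S" 
  proof -
    have "S <#> {\<one>} = S" using S.subset by (force simp: set_mult_def)
    then have "k {} * card S = n"
      using lagrange_finite[OF fin(1) S.subgroup_axioms] by (simp add: k_def n_def generate_empty)
    then show ?thesis using S2 by (simp add: field_simps flip: of_nat_mult)
  qed
  have z1: "z {} = card (V0 S)" by (simp add: z_def Z.fixed_pts_def V0_def)
  have eq1: "m ^ n = m ^ k {} * card (V0 S)"
  proof -
    have "S <#> {\<one>} = S" using S.subset by (force simp: set_mult_def)
    then have "subgroup (S <#> generate G {}) G" using S.subgroup_axioms by (simp add: generate_empty)
    then have "m ^ card (rcosets {\<one>}) = m ^ k {} * z {}" using split[of "{}"] by (simp add: generate_empty)
    then show ?thesis using card_rcosets_triv fin(1) by (simp add: z1 n_def)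
  qed
  show ?thesis
  proof (rule ccontr)
    assume "\<not> ?thesis"
    then have le: "card (V0 S) \<le> z {a} * z {b} * z {c}"
      by (simp add: z_def V0_def)
    \<comment> \<open>Multiplying by the sizes of the \<open>S\<close>-fixed parts turns every
      factor into a power of \<open>m\<close>, so the assumed inequality becomes one between
      exponents.\<close>
    have "m ^ (n + (k {a} + k {b} + k {c})) = m ^ k {} * (m ^ k {a} * m ^ k {b} * m ^ k {c}) * card (V0 S)"
      by (simp add: power_add eq1)
    also have "\<dots> \<le> m ^ k {} * (m ^ k {a} * m ^ k {b} * m ^ k {c}) * (z {a} * z {b} * z {c})"
      using le by (rule mult_le_mono2)
    also have "\<dots> = m ^ k {} * ((m ^ k {a} * z {a}) * (m ^ k {b} * z {b}) * (m ^ k {c} * z {c}))"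
      by (simp add: mult_ac)
    also have "\<dots> = m ^ (k {} + (o' a + o' b + o' c))"
      using ab by (simp add: power_add eq[symmetric])
    finally have "n + (k {a} + k {b} + k {c}) \<le> k {} + (o' a + o' b + o' c)"
      using M2 by (simp add: m_def power_increasing_iff)
    then have "real n + (real (k {a}) + k {b} + k {c}) \<le> real (k {}) + (real (o' a) + o' b + o' c)"
      by (simp flip: of_nat_add)
    then have "real n + (n / (card S * ord a) + n / (card S * ord b) + n / (card S * ord c))
        \<le> n / card S + (n / ord a + n / ord b + n / ord c)"
      using kx[OF ab(1)] kx[OF ab(2)] kx[OF ab(3)] unfolding k1 o[OF ab(1)] o[OF ab(2)] o[OF ab(3)]
      by linarith
    moreover define P where "P = 1 / real (ord a) + 1 / real (ord b) + 1 / real (ord c)"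
    ultimately have "real n + n / card S * P \<le> n / card S + n * P"
      by (simp add: P_def algebra_simps)
    \<comment> \<open>The inequality factors: since \<open>P < 1\<close> and
      \<open>|S| \<ge> 2\<close>, the product is also positive.\<close>
    then have "real n * ((1 - P) * (1 - 1 / card S)) \<le> 0"
      by (simp add: algebra_simps diff_divide_distrib)
    moreover have "real n * ((1 - P) * (1 - 1 / card S)) > 0"
      using hyp S2 n0 unfolding P_def by (intro mult_pos_pos) simp_all
    ultimately show False by simp
  qed
qed

end

subsection \<open>The triangle group and its quotients\<close>

lemma (in normal) r_coset_eq_iff:
  assumes "x \<in> carrier G"
  shows "H #> x = H \<longleftrightarrow> x \<in> H"
  using rcos_const[OF is_group] coset_join1[OF _ assms subgroup_axioms] by blast

lemma (in group_hom) ord_Mod_kernel: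
  assumes "x \<in> carrier G"
  shows "group.ord (G Mod kernel G H h) (kernel G H h #>\<^bsub>G\<^esub> x) = group.ord H (h x)"
proof -
  interpret K: normal "kernel G H h" G by (rule normal_kernel)
  interpret Q: group "G Mod kernel G H h" by (rule K.factorgroup_is_group)
  have X: "kernel G H h #>\<^bsub>G\<^esub> x \<in> carrier (G Mod kernel G H h)"
    unfolding carrier_FactGroup using assms by (rule imageI)
  have "(kernel G H h #>\<^bsub>G\<^esub> x) [^]\<^bsub>G Mod kernel G H h\<^esub> n = \<one>\<^bsub>G Mod kernel G H h\<^esub> \<longleftrightarrow> h x [^]\<^bsub>H\<^esub> n = \<one>\<^bsub>H\<^esub>" for n :: nat
  proof -
    have "(kernel G H h #>\<^bsub>G\<^esub> x) [^]\<^bsub>G Mod kernel G H h\<^esub> n = kernel G H h #>\<^bsub>G\<^esub> (x [^] n)"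
      using assms by (rule K.FactGroup_pow)
    moreover have "kernel G H h #>\<^bsub>G\<^esub> (x [^] n) = kernel G H h \<longleftrightarrow> x [^] n \<in> kernel G H h"
      using assms by (intro K.r_coset_eq_iff) simp
    moreover have "x [^] n \<in> kernel G H h \<longleftrightarrow> h x [^]\<^bsub>H\<^esub> n = \<one>\<^bsub>H\<^esub>"
      using assms hom_nat_pow[OF assms, of n] unfolding kernel_def by simp
    ultimately show ?thesis by (simp only: one_FactGroup)
  qed
  then have dvd: "Q.ord (kernel G H h #>\<^bsub>G\<^esub> x) dvd n \<longleftrightarrow> H.ord (h x) dvd n" for n
    unfolding Q.pow_eq_id[OF X, symmetric] H.pow_eq_id[OF hom_closed[OF assms], symmetric] .
  show ?thesis
    by (rule dvd_antisym) (use dvd[of "H.ord (h x)"] dvd[of "Q.ord (kernel G H h #>\<^bsub>G\<^esub> x)"] in simp_all)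
qed

text \<open>The projection carries the derived series onto that of the quotient, so the derived
  length of a quotient can be read off inside \<open>G\<close> from \<open>H\<close>.\<close>

lemma (in normal) exp_of_derived_Mod_trivial_iff:
  "(derived (G Mod H) ^^ n) (carrier (G Mod H)) = {\<one>\<^bsub>G Mod H\<^esub>}
    \<longleftrightarrow> (derived G ^^ n) (carrier G) \<subseteq> H"
proof -
  interpret \<rho>: group_hom G "G Mod H" "\<lambda>x. H #> x"
    by (rule group_hom.intro[OF is_group factorgroup_is_group])
      (simp add: group_hom_axioms_def r_coset_hom_Mod)
  define A where "A = (derived G ^^ n) (carrier G)"
  have A: "subgroup A G"
    unfolding A_def by (rule exp_of_derived_is_subgroup[OF subgroup_self])
  have "(derived (G Mod H) ^^ n) (carrier (G Mod H)) = (\<lambda>x. H #> x) ` A"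
    unfolding A_def carrier_FactGroup by (rule \<rho>.exp_of_derived_img) simp
  also have "\<dots> = {\<one>\<^bsub>G Mod H\<^esub>} \<longleftrightarrow> (\<forall>x\<in>A. H #> x = H)"
    using subgroup.one_closed[OF A] unfolding one_FactGroup by blast
  also have "\<dots> \<longleftrightarrow> A \<subseteq> H"
    using r_coset_eq_iff subgroup.mem_carrier[OF A] by blast
  finally show ?thesis by (simp add: A_def)
qed

lemma (in normal) derived_length_Mod:
  "derived_length (G Mod H) = (LEAST n. (derived G ^^ n) (carrier G) \<subseteq> H)"
  unfolding derived_length_def exp_of_derived_Mod_trivial_iff ..

lemma (in group) exp_of_derived_decreasing:
  assumes "m \<le> n"
  shows "(derived G ^^ n) (carrier G) \<subseteq> (derived G ^^ m) (carrier G)"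
  using assms
proof (induction n rule: dec_induct)
  case (step n)
  have "derived G ((derived G ^^ n) (carrier G)) \<subseteq> (derived G ^^ n) (carrier G)"
    by (rule derived_incl[OF subset_refl exp_of_derived_is_subgroup[OF subgroup_self]])
  then show ?case using step by simp
qed simp

text \<open>By commutativity \<open>y^q = 1\<close> and \<open>(x y)^r = 1\<close> give
  \<open>x^(r q) = 1\<close>, so the order of \<open>x\<close> divides both \<open>p\<close> and the
  coprime number \<open>r q\<close>.\<close>

lemma (in comm_group) coprime_triple_trivial:
  fixes p q r :: nat
  assumes "x \<in> carrier G" "y \<in> carrier G"
    and "x [^] p = \<one>" "y [^] q = \<one>" "(x \<otimes> y) [^] r = \<one>"
    and "coprime p q" "coprime p r"
  shows "x = \<one>"
proof -
  have "x [^] (r * q) = x [^] (r * q) \<otimes> y [^] (q * r)"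
    using assms(1,2,4) nat_pow_pow[OF assms(2), of q r] by simp
  also have "\<dots> = (x \<otimes> y) [^] (r * q)"
    using assms(1,2) by (simp add: nat_pow_distrib mult.commute)
  also have "\<dots> = ((x \<otimes> y) [^] r) [^] q"
    using assms(1,2) by (simp add: nat_pow_pow)
  also have "\<dots> = \<one>" using assms by simp
  finally have "ord x dvd r * q" using assms by (simp add: pow_eq_id)
  moreover have "ord x dvd p" using assms by (simp add: pow_eq_id)
  ultimately have "ord x = 1"
    using assms(6,7) by (metis coprime_common_divisor_nat coprime_mult_right_iff mult.commute nat_dvd_1_iff_1)
  then show ?thesis using ord_eq_1[OF assms(1)] by simp
qed

section \<open>Words and their values\<close>

lemma (in group) evw_closed [simp]:
  assumes "a \<in> carrier G" "b \<in> carrier G"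
  shows "evw G a b w \<in> carrier G"
  by (induction w) (use assms in \<open>auto simp: Let_def\<close>)

lemma (in group) evw_append:
  assumes "a \<in> carrier G" "b \<in> carrier G"
  shows "evw G a b (u @ v) = evw G a b u \<otimes> evw G a b v"
  by (induction u) (use assms in \<open>auto simp: Let_def m_assoc\<close>)

definition inverse_word :: "tword \<Rightarrow> tword" where
  "inverse_word w = rev (map (apsnd Not) w)"

lemma (in group) evw_inverse_word:
  assumes "a \<in> carrier G" "b \<in> carrier G"
  shows "evw G a b (inverse_word w) = inv (evw G a b w)"
proof (induction w)
  case (Cons l w)
  have "evw G a b (inverse_word (l # w)) = inv (evw G a b w) \<otimes> evw G a b [apsnd Not l]"
    using Cons assms by (simp add: inverse_word_def evw_append)
  also have "evw G a b [apsnd Not l] = inv (evw G a b [l])"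
    using assms by (cases l) (auto simp: Let_def)
  also have "inv (evw G a b w) \<otimes> inv (evw G a b [l]) = inv (evw G a b ([l] @ w))"
    using assms by (subst evw_append) (auto simp: inv_mult_group simp del: evw.simps)
  finally show ?case by simp
qed (simp add: inverse_word_def)

lemma (in group_hom) evw_hom:
  assumes "a \<in> carrier G" "b \<in> carrier G"
  shows "evw H (h a) (h b) w = h (evw G a b w)"
  by (induction w) (use assms in \<open>auto simp: Let_def\<close>)

lemma (in group) evw_in_generate:
  assumes "a \<in> carrier G" "b \<in> carrier G"
  shows "evw G a b w \<in> generate G {a, b}"
proof (induction w)
  case (Cons l w)
  have "evw G a b [l] \<in> generate G {a, b}"
    using assms by (cases l) (auto simp: Let_def intro: generate.intros)
  then have "evw G a b [l] \<otimes> evw G a b w \<in> generate G {a, b}"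
    using Cons by (rule generate.eng)
  then show ?case using assms by (simp add: evw_append[of a b "[l]" w, simplified, symmetric] del: evw.simps)
qed (simp add: generate.one)

lemma (in group) evw_replicate:
  assumes "a \<in> carrier G" "b \<in> carrier G"
  shows "evw G a b (concat (replicate n w)) = evw G a b w [^] n"
  by (induction n) (use assms in \<open>simp_all add: evw_append nat_pow_Suc2[symmetric] del: nat_pow_Suc\<close>)

definition triangle_rels :: "('a, 'b) monoid_scheme \<Rightarrow> nat \<Rightarrow> nat \<Rightarrow> nat \<Rightarrow> 'a \<Rightarrow> 'a \<Rightarrow> bool" where
  "triangle_rels G p q r a b \<longleftrightarrow> a \<in> carrier G \<and> b \<in> carrier G \<and>
    a [^]\<^bsub>G\<^esub> p = \<one>\<^bsub>G\<^esub> \<and> b [^]\<^bsub>G\<^esub> q = \<one>\<^bsub>G\<^esub> \<and> (a \<otimes>\<^bsub>G\<^esub> b) [^]\<^bsub>G\<^esub> r = \<one>\<^bsub>G\<^esub>"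

lemma (in group_hom) triangle_rels_hom:
  assumes "triangle_rels G p q r a b"
  shows "triangle_rels H p q r (h a) (h b)"
  using assms unfolding triangle_rels_def
  by (metis G.m_closed hom_closed hom_mult hom_nat_pow hom_one)

lemma tri_rel_iff:
  "tri_rel p q r w v \<longleftrightarrow>
    (\<forall>(G :: nat monoid) a b. group G \<and> triangle_rels G p q r a b \<longrightarrow> evw G a b w = evw G a b v)"
  by (auto simp: tri_rel_def triangle_rels_def)

text \<open>\<open>tri_rel\<close> speaks of groups on \<open>nat\<close>; a finite group on any
  type is copied there along an injection, and the equality of values is pulled back.\<close>

lemma tri_rel_finite_group:
  assumes rel: "tri_rel p q r w v" and G: "group G" "finite (carrier G)" and ab: "triangle_rels G p q r a b"
  shows "evw G a b w = evw G a b v"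
proof -
  obtain f :: "'a \<Rightarrow> nat" where f: "inj_on f (carrier G)"
    using finite_imp_inj_to_nat_seg[OF G(2)] by blast
  define N where "N = image_group f G"
  have N: "group N" unfolding N_def by (rule group.inj_imp_image_group_is_group[OF G(1) f])
  have "f \<in> iso G N" unfolding N_def by (rule inj_imp_image_group_iso[OF f])
  then interpret f: group_hom G N f
    using G N by (simp add: group_hom_def group_hom_axioms_def iso_def)
  have "evw N (f a) (f b) w = evw N (f a) (f b) v"
    using rel N f.triangle_rels_hom[OF ab] unfolding tri_rel_iff by blast
  moreover have "a \<in> carrier G" "b \<in> carrier G" using ab by (auto simp: triangle_rels_def)
  ultimately show ?thesis
    using f f.G.evw_closed by (simp add: f.evw_hom inj_on_eq_iff)
qed

section \<open>The triangle group as a group of word classes\<close>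

locale triangle =
  fixes p q r :: nat
begin

abbreviation T where "T \<equiv> triangle_group p q r"
abbreviation x where "x \<equiv> tri_x p q r"
abbreviation y where "y \<equiv> tri_y p q r"

definition cls :: "tword \<Rightarrow> tword set" where
  "cls w = {v. tri_rel p q r v w}"

lemma tri_rel_refl: "tri_rel p q r w w"
  and tri_rel_sym: "tri_rel p q r w v \<Longrightarrow> tri_rel p q r v w"
  and tri_rel_trans: "tri_rel p q r u v \<Longrightarrow> tri_rel p q r v w \<Longrightarrow> tri_rel p q r u w"
  by (auto simp: tri_rel_def)

lemma tri_rel_append: "\<lbrakk>tri_rel p q r u u'; tri_rel p q r v v'\<rbrakk> \<Longrightarrow> tri_rel p q r (u @ v) (u' @ v')"
  unfolding tri_rel_iff by (auto simp: group.evw_append triangle_rels_def)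

lemma cls_eq_iff: "cls u = cls v \<longleftrightarrow> tri_rel p q r u v"
  unfolding cls_def using tri_rel_refl tri_rel_sym tri_rel_trans by blast

lemma carrier_T: "carrier T = range cls"
proof -
  have "{(w, v). tri_rel p q r w v} `` {w} = cls w" for w
    using tri_rel_sym by (auto simp: cls_def)
  then show ?thesis by (auto simp: triangle_group_def quotient_def)
qed

lemma mult_cls [simp]: "cls u \<otimes>\<^bsub>T\<^esub> cls v = cls (u @ v)"
proof -
  have "tri_rel p q r w (u @ v) \<longleftrightarrow> (\<exists>u'\<in>cls u. \<exists>v'\<in>cls v. tri_rel p q r w (u' @ v'))" for w
    unfolding cls_def using tri_rel_refl tri_rel_append tri_rel_trans by blast
  then show ?thesis by (auto simp: triangle_group_def cls_def)
qed

lemma one_T: "\<one>\<^bsub>T\<^esub> = cls []"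
  by (simp add: triangle_group_def cls_def)

lemma tri_x_cls: "x = cls [(True, False)]"
  and tri_y_cls: "y = cls [(False, False)]"
  by (simp_all add: tri_x_def tri_y_def cls_def)

lemma cls_inverse_word_mult: "cls (inverse_word w) \<otimes>\<^bsub>T\<^esub> cls w = \<one>\<^bsub>T\<^esub>"
proof -
  have "tri_rel p q r (inverse_word w @ w) []"
    unfolding tri_rel_iff
    by (auto simp: triangle_rels_def group.evw_append group.evw_inverse_word group.l_inv group.evw_closed)
  then show ?thesis by (simp add: one_T cls_eq_iff)
qed

lemma group_T: "group T"
proof (rule groupI)
  fix A assume "A \<in> carrier T"
  then obtain w where w: "A = cls w" by (auto simp: carrier_T)
  have "cls (inverse_word w) \<otimes>\<^bsub>T\<^esub> A = \<one>\<^bsub>T\<^esub>"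
    by (simp only: w cls_inverse_word_mult)
  then show "\<exists>B\<in>carrier T. B \<otimes>\<^bsub>T\<^esub> A = \<one>\<^bsub>T\<^esub>"
    by (auto simp: carrier_T)
qed (auto simp: carrier_T one_T)

sublocale T: group T by (rule group_T)

lemma xy_carrier [simp]: "x \<in> carrier T" "y \<in> carrier T"
  by (auto simp: carrier_T tri_x_cls tri_y_cls)

lemma inv_cls: "inv\<^bsub>T\<^esub> (cls w) = cls (inverse_word w)"
  by (rule T.inv_equality[OF cls_inverse_word_mult]) (auto simp: carrier_T)

lemma evw_T: "evw T x y w = cls w"
proof (induction w)
  case (Cons l w)
  have "evw T x y [l] = cls [l]"
    by (cases l) (auto simp: Let_def tri_x_cls tri_y_cls inv_cls inverse_word_def one_T)
  then have "evw T x y ([l] @ w) = cls ([l] @ w)"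
    using Cons by (subst T.evw_append) auto
  then show ?case by simp
qed (simp add: one_T)

lemma generate_T: "generate T {x, y} = carrier T"
proof
  show "generate T {x, y} \<subseteq> carrier T" by (rule T.generate_incl) simp
  show "carrier T \<subseteq> generate T {x, y}"
    using T.evw_in_generate[OF xy_carrier] by (auto simp: carrier_T evw_T[symmetric])
qed

lemma triangle_rels_T: "triangle_rels T p q r x y"
proof -
  \<comment> \<open>The power of a word is the value of the repeated word, so a power relation valid
    in every group considered by \<open>tri_rel\<close> is an equality of classes in
    \<open>T\<close>.\<close>
  have *: "evw T x y w [^]\<^bsub>T\<^esub> n = \<one>\<^bsub>T\<^esub>"
    if "\<And>(G :: nat monoid) a b. \<lbrakk>group G; triangle_rels G p q r a b\<rbrakk> \<Longrightarrow> evw G a b w [^]\<^bsub>G\<^esub> n = \<one>\<^bsub>G\<^esub>" for n :: nat and w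
  proof -
    have "tri_rel p q r (concat (replicate n w)) []"
      unfolding tri_rel_iff using that by (auto simp: group.evw_replicate triangle_rels_def)
    then have "evw T x y (concat (replicate n w)) = \<one>\<^bsub>T\<^esub>"
      by (simp add: evw_T one_T cls_eq_iff)
    then show ?thesis by (simp add: T.evw_replicate)
  qed
  have "x [^]\<^bsub>T\<^esub> p = \<one>\<^bsub>T\<^esub>"
    using *[of "[(True, False)]" p] by (simp add: triangle_rels_def group.is_monoid monoid.r_one)
  moreover have "y [^]\<^bsub>T\<^esub> q = \<one>\<^bsub>T\<^esub>"
    using *[of "[(False, False)]" q] by (simp add: triangle_rels_def group.is_monoid monoid.r_one)
  moreover have "(x \<otimes>\<^bsub>T\<^esub> y) [^]\<^bsub>T\<^esub> r = \<one>\<^bsub>T\<^esub>"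
    using *[of "[(True, False), (False, False)]" r] by (simp add: triangle_rels_def group.is_monoid monoid.r_one)
  ultimately show ?thesis by (simp add: triangle_rels_def)
qed

text \<open>Universal property for finite targets: evaluating a representative word is well defined
  because equivalent words agree in every finite group satisfying the relations.\<close>

lemma hom_exists:
  assumes G: "group G" "finite (carrier G)" and ab: "triangle_rels G p q r a b"
  obtains \<phi> where "group_hom T G \<phi>" "\<phi> x = a" "\<phi> y = b"
proof -
  define \<phi> where "\<phi> A = evw G a b (SOME w. A = cls w)" for A
  have \<phi>: "\<phi> (cls w) = evw G a b w" for w
  proof -
    have "tri_rel p q r w (SOME v. cls w = cls v)"
      using someI[of "\<lambda>v. cls w = cls v" w] by (simp add: cls_eq_iff)
    then show ?thesis using tri_rel_finite_group[OF _ G ab] by (simp add: \<phi>_def)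
  qed
  interpret G: group G by fact
  have c: "a \<in> carrier G" "b \<in> carrier G" using ab by (auto simp: triangle_rels_def)
  have "\<phi> \<in> hom T G"
    using c by (auto simp: hom_def carrier_T \<phi> G.evw_append)
  then have "group_hom T G \<phi>"
    by (simp add: group_hom_def group_hom_axioms_def T.is_group G.is_group)
  moreover have "\<phi> x = a" "\<phi> y = b"
    using c by (simp_all add: tri_x_cls tri_y_cls \<phi>)
  ultimately show thesis by (rule that)
qed

text \<open>Used contrapositively: failure of perfectness supplies two periods with a common factor.
  In the abelianization both generators become trivial by \<open>coprime_triple_trivial\<close>, so
  the derived subgroup contains them.\<close>

lemma perfect_if_coprime:
  assumes "coprime p q" "coprime p r" "coprime q r"
  shows "perfect_group T"
proof -
  define D where "D = derived T (carrier T)"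
  interpret D: normal D T unfolding D_def by (rule T.derived_self_is_normal)
  interpret Q: comm_group "T Mod D" unfolding D_def by (rule T.derived_quot_is_comm_group)
  interpret \<rho>: group_hom T "T Mod D" "\<lambda>t. D #>\<^bsub>T\<^esub> t"
    by (rule group_hom.intro[OF T.is_group Q.is_group])
      (simp add: group_hom_axioms_def D.r_coset_hom_Mod)
  have rels: "triangle_rels (T Mod D) p q r (D #>\<^bsub>T\<^esub> x) (D #>\<^bsub>T\<^esub> y)"
    by (rule \<rho>.triangle_rels_hom[OF triangle_rels_T])
  note R = rels[unfolded triangle_rels_def]
  have "D #>\<^bsub>T\<^esub> x = \<one>\<^bsub>T Mod D\<^esub>"
    by (rule Q.coprime_triple_trivial[of _ "D #>\<^bsub>T\<^esub> y" p q r]) (use R assms in blast)+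
  \<comment> \<open>The same argument with \<open>p\<close> and \<open>q\<close> exchanged;
    commutativity of the quotient turns \<open>x y\<close> into \<open>y x\<close>.\<close>
  moreover have "D #>\<^bsub>T\<^esub> y = \<one>\<^bsub>T Mod D\<^esub>"
  proof (rule Q.coprime_triple_trivial[of _ "D #>\<^bsub>T\<^esub> x" q p r])
    show "((D #>\<^bsub>T\<^esub> y) \<otimes>\<^bsub>T Mod D\<^esub> (D #>\<^bsub>T\<^esub> x)) [^]\<^bsub>T Mod D\<^esub> r = \<one>\<^bsub>T Mod D\<^esub>"
      using R Q.m_comm by metis
    show "coprime q p" "coprime q r" using assms by (simp_all add: coprime_commute)
  qed (use R in blast)+
  ultimately have "{x, y} \<subseteq> D"
    using D.r_coset_eq_iff by simp
  then have "generate T {x, y} \<subseteq> D"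
    by (rule T.generate_subgroup_incl[OF _ D.subgroup_axioms])
  then show ?thesis using D.subset by (auto simp: perfect_group_def D_def generate_T)
qed

text \<open>The image of \<open>\<phi>\<close> may be proper, so the quotient is compared with the
  image. Its cardinality is recorded because kernels are told apart later by the size of their
  quotients.\<close>

lemma kernel_smooth:
  assumes \<phi>: "group_hom T G \<phi>" and fin: "finite (carrier G)"
    and "group.ord G (\<phi> x) = p" "group.ord G (\<phi> y) = q" "group.ord G (\<phi> x \<otimes>\<^bsub>G\<^esub> \<phi> y) = r"
    and d: "(derived T ^^ d) (carrier T) \<subseteq> kernel T G \<phi>"
  shows "smooth_fin_sol_quotient p q r (kernel T G \<phi>)"
    and "card (carrier (T Mod kernel T G \<phi>)) = card (\<phi> ` carrier T)"
proof -
  interpret \<phi>: group_hom T G \<phi> by fact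
  interpret K: normal "kernel T G \<phi>" T by (rule \<phi>.normal_kernel)
  interpret Q: group "T Mod kernel T G \<phi>" by (rule K.factorgroup_is_group)
  have "bij_betw (\<lambda>R. the_elem (\<phi> ` R)) (carrier (T Mod kernel T G \<phi>)) (\<phi> ` carrier T)"
  proof -
    have el: "the_elem (\<phi> ` (kernel T G \<phi> #>\<^bsub>T\<^esub> t)) = \<phi> t" if t: "t \<in> carrier T" for t
    proof -
      have "\<phi> ` (kernel T G \<phi> #>\<^bsub>T\<^esub> t) = {\<phi> t}"
      proof (rule equalityI)
        show "{\<phi> t} \<subseteq> \<phi> ` (kernel T G \<phi> #>\<^bsub>T\<^esub> t)"
          using T.rcos_self[OF t K.subgroup_axioms] by blast
        show "\<phi> ` (kernel T G \<phi> #>\<^bsub>T\<^esub> t) \<subseteq> {\<phi> t}"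
        proof (rule image_subsetI)
          fix u assume "u \<in> kernel T G \<phi> #>\<^bsub>T\<^esub> t"
          then obtain k where "k \<in> carrier T" "\<phi> k = \<one>\<^bsub>G\<^esub>" "u = k \<otimes>\<^bsub>T\<^esub> t"
            unfolding r_coset_def kernel_def by blast
          then show "\<phi> u \<in> {\<phi> t}" using t by simp
        qed
      qed
      then show ?thesis by simp
    qed
    then have "(\<lambda>R. the_elem (\<phi> ` R)) ` carrier (T Mod kernel T G \<phi>) = \<phi> ` carrier T"
      unfolding carrier_FactGroup image_image by (intro image_cong) simp_all
    then show ?thesis using \<phi>.FactGroup_inj_on unfolding bij_betw_def by blast
  qed
  note bij = this
  then show "card (carrier (T Mod kernel T G \<phi>)) = card (\<phi> ` carrier T)"
    by (rule bij_betw_same_card)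
  have "finite (\<phi> ` carrier T)"
    using fin \<phi>.hom_closed by (meson finite_subset image_subsetI)
  with bij have "finite (carrier (T Mod kernel T G \<phi>))"
    using bij_betw_finite by blast
  moreover have "solvable (T Mod kernel T G \<phi>)"
    using d K.exp_of_derived_Mod_trivial_iff[of d] unfolding Q.solvable_iff_trivial_derived_seq by blast
  ultimately show "smooth_fin_sol_quotient p q r (kernel T G \<phi>)"
    using assms(3-5) K.normal_axioms \<phi>.ord_Mod_kernel[OF xy_carrier(1)] \<phi>.ord_Mod_kernel[OF xy_carrier(2)]
      \<phi>.ord_Mod_kernel[OF T.m_closed[OF xy_carrier]] \<phi>.hom_mult[OF xy_carrier]
    unfolding smooth_fin_sol_quotient_def Let_def by metis
qed

end

subsection \<open>Triples of elements of prescribed orders\<close>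

context gmod
begin

text \<open>The projection to \<open>G\<close> kills the \<open>n\<close>-th derived subgroup, which
  therefore lies in the copy of \<open>V\<close>; that copy is commutative, so one more step ends
  the series.\<close>

lemma exp_of_derived_sdp:
  assumes "(derived G ^^ n) (carrier G) = {\<one>}"
  shows "(derived sdp ^^ Suc n) (carrier sdp) = {\<one>\<^bsub>sdp\<^esub>}"
proof -
  interpret E: group sdp by (rule group_sdp)
  interpret \<pi>: group_hom sdp G snd by (rule snd_sdp_hom)
  define A where "A = (derived sdp ^^ n) (carrier sdp)"
  have "snd ` carrier sdp = carrier G"
    using zero_V by (auto simp: snd_image_times simp del: zero_V)
  then have "snd ` A = {\<one>}"
    using \<pi>.exp_of_derived_img[of "carrier sdp" n] assms unfolding A_def by simp
  moreover have "A \<subseteq> carrier sdp"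
    unfolding A_def by (rule E.exp_of_derived_in_carrier) simp
  ultimately have A: "\<exists>v\<in>V. z = (v, \<one>)" if "z \<in> A" for z
    using that by (metis imageI mem_Times_iff prod.collapse sdp_simps(1) singletonD subsetD)
  have "derived_set sdp A \<subseteq> {\<one>\<^bsub>sdp\<^esub>}"
  proof
    fix c assume "c \<in> derived_set sdp A"
    then obtain h k where hk: "h \<in> A" "k \<in> A"
      and c: "c = h \<otimes>\<^bsub>sdp\<^esub> k \<otimes>\<^bsub>sdp\<^esub> inv\<^bsub>sdp\<^esub> h \<otimes>\<^bsub>sdp\<^esub> inv\<^bsub>sdp\<^esub> k"
      by blast
    from hk obtain v w where "v \<in> V" "w \<in> V" "h = (v, \<one>)" "k = (w, \<one>)" using A by meson
    then show "c \<in> {\<one>\<^bsub>sdp\<^esub>}"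
      by (simp add: c sdp_inv)
  qed
  then have "derived sdp A \<subseteq> {\<one>\<^bsub>sdp\<^esub>}"
    unfolding derived_def by (rule E.generate_subgroup_incl[OF _ E.triv_subgroup])
  moreover have "\<one>\<^bsub>sdp\<^esub> \<in> derived sdp A"
    unfolding derived_def by (rule generate.one)
  ultimately show ?thesis by (auto simp: A_def)
qed

lemma norm_sum_mult:
  assumes "v \<in> V" "g \<in> carrier G" "g [^] n = \<one>"
  shows "norm_sum (n * j) g v = nmul j (norm_sum n g v)"
proof -
  interpret E: group sdp by (rule group_sdp)
  have "(v, g) [^]\<^bsub>sdp\<^esub> (n * j) = ((v, g) [^]\<^bsub>sdp\<^esub> n) [^]\<^bsub>sdp\<^esub> j"
    using assms by (simp add: E.nat_pow_pow)
  also have "\<dots> = (nmul j (norm_sum n g v), \<one>)"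
    using assms by (simp add: sdp_pow norm_sum_one)
  finally show ?thesis using assms by (simp add: sdp_pow)
qed

text \<open>A trivial power of \<open>(v, g)\<close> needs an exponent divisible by
  \<open>ord g\<close>, and the power \<open>ord g\<close> is a pure vector. The number
  \<open>m\<close> is the additive order of that vector, expressed by divisibility.\<close>

lemma ord_sdp:
  assumes "v \<in> V" "g \<in> carrier G" "\<And>j. nmul j (norm_sum (ord g) g v) = 0 \<longleftrightarrow> m dvd j"
  shows "group.ord sdp (v, g) = ord g * m"
proof -
  interpret E: group sdp by (rule group_sdp)
  have vg: "(v, g) \<in> carrier sdp" using assms by simp
  have "(v, g) [^]\<^bsub>sdp\<^esub> n = \<one>\<^bsub>sdp\<^esub> \<longleftrightarrow> ord g * m dvd n" for n :: nat
  proof (cases "ord g dvd n")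
    case True
    then obtain j where j: "n = ord g * j" by auto
    have "(v, g) [^]\<^bsub>sdp\<^esub> n = (nmul j (norm_sum (ord g) g v), \<one>)"
      using assms True by (simp add: sdp_pow norm_sum_mult j pow_eq_id)
    then have *: "(v, g) [^]\<^bsub>sdp\<^esub> n = \<one>\<^bsub>sdp\<^esub> \<longleftrightarrow> m dvd j"
      using assms(3) by simp
    show ?thesis
    proof (cases "ord g = 0")
      case True
      \<comment> \<open>Here \<open>g\<close> has infinite order: the norm is an empty sum, and the
        hypothesis forces \<open>m = 1\<close>.\<close>
      then have "norm_sum (ord g) g v = 0" by (simp add: norm_sum_def)
      then have "m dvd 1" using assms(3)[of 1] by simp
      then show ?thesis using * True j by simp
    qed (use * in \<open>simp add: j\<close>)
  next
    case False
    then have "g [^] n \<noteq> \<one>" using assms by (simp add: pow_eq_id)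
    then have "(v, g) [^]\<^bsub>sdp\<^esub> n \<noteq> \<one>\<^bsub>sdp\<^esub>" using assms by (simp add: sdp_pow)
    moreover have "\<not> ord g * m dvd n" using False by (meson dvd_mult_left)
    ultimately show ?thesis by simp
  qed
  then show ?thesis using E.ord_unique[OF vg] by blast
qed

lemma ord_sdp_split:
  assumes "v \<in> V" "g \<in> carrier G" "norm_sum (ord g) g v = 0"
  shows "group.ord sdp (v, g) = ord g"
  using ord_sdp[of v g 1] assms by simp

end

lemma sum_apply: "(\<Sum>i\<in>A. f i) k = (\<Sum>i\<in>A. f i k)"
  by (induction A rule: infinite_finite_induct) simp_all

section \<open>Point masses and the construction of the triples\<close>

context group
begin

definition delta :: "'v::ab_group_add \<Rightarrow> 'a \<Rightarrow> 'a \<Rightarrow> 'v" where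
  "delta e h = (\<lambda>k. if k = h then e else 0)"

lemma delta_in_funs: "\<lbrakk>h \<in> carrier G; e \<in> M; 0 \<in> M\<rbrakk> \<Longrightarrow> delta e h \<in> funs M"
  by (auto simp: delta_def funs_def)

lemma translate_delta:
  assumes "g \<in> carrier G" "h \<in> carrier G"
  shows "translate g (delta e h) = delta e (g \<otimes> h)"
proof
  fix k
  have "inv g \<otimes> k = h \<longleftrightarrow> k = g \<otimes> h" if "k \<in> carrier G"
    using assms that by (metis inv_cancel_left)
  then show "translate g (delta e h) k = delta e (g \<otimes> h) k"
    using assms by (auto simp: translate_def delta_def)
qed

lemma nmul_delta_eq_0: "nmul j e = 0 \<Longrightarrow> nmul j (delta e h) = 0"
  by (simp add: fun_eq_iff nmul_fun delta_def)

lemma one_over_in_torsion: "n > 0 \<Longrightarrow> n dvd m \<Longrightarrow> qz_of (1 / of_nat n) \<in> torsion m"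
  by (simp add: torsion_def nmul_qz_of_inverse_eq_0_iff)

text \<open>The chosen \<open>y\<close> is the conjugate of \<open>x^-1\<close> by
  \<open>(- u, \<one>)\<close>, so both have order \<open>n\<close>, while \<open>x y\<close> is the
  pure vector \<open>u - g u\<close>, whose value \<open>e\<close> at \<open>\<one>\<close> has
  order \<open>r\<close>. The two families of inequalities are the input for
  \<open>exists_triple_lift\<close>.\<close>

lemma exists_triple_over_cyclic:
  assumes fin: "finite (carrier G)" and g: "g \<in> carrier G" "ord g = n" "2 \<le> n" and r: "2 \<le> r"
    and d: "(derived G ^^ d) (carrier G) = {\<one>}"
  shows "\<exists>(H :: (('a \<Rightarrow> qz) \<times> 'a) monoid) x y. group H \<and> finite (carrier H) \<and>
    x \<in> carrier H \<and> y \<in> carrier H \<and>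
    group.ord H x = n \<and> group.ord H y = n \<and> group.ord H (x \<otimes>\<^bsub>H\<^esub> y) = r \<and>
    (\<forall>i::nat. x [^]\<^bsub>H\<^esub> i \<otimes>\<^bsub>H\<^esub> (x \<otimes>\<^bsub>H\<^esub> y) \<noteq> \<one>\<^bsub>H\<^esub>) \<and> (\<forall>i::nat. y [^]\<^bsub>H\<^esub> i \<otimes>\<^bsub>H\<^esub> x \<noteq> \<one>\<^bsub>H\<^esub>) \<and>
    (derived H ^^ Suc d) (carrier H) = {\<one>\<^bsub>H\<^esub>}"
proof -
  define M where "M = (torsion r :: qz set)"
  interpret F: gmod G translate "funs M" unfolding M_def by (rule gmod_funs_torsion)
  interpret E: group F.sdp by (rule F.group_sdp)
  define e where "e = qz_of (1 / of_nat r)"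
  have eM: "e \<in> M" using r by (simp add: e_def M_def one_over_in_torsion)
  define u where "u = delta e \<one>"
  have u: "u \<in> funs M" using eM by (simp add: u_def delta_in_funs M_def torsion_closed)
  define x where "x = (0 :: 'a \<Rightarrow> qz, g)"
  define y where "y = (translate (inv g) u - u, inv g)"
  have car: "x \<in> carrier F.sdp" "y \<in> carrier F.sdp"
    using u g by (simp_all add: x_def y_def)
  have xy: "x \<otimes>\<^bsub>F.sdp\<^esub> y = (u - translate g u, \<one>)"
    using u g by (simp add: x_def y_def F.act_diff)
  have gn: "ord (inv g) = n" using g by simp
  have ordx: "E.ord x = n"
    unfolding x_def using g F.norm_sum_of_fixed[of 0 g n] by (subst F.ord_sdp_split) simp_all
  have "inv g [^] n = \<one>" using pow_ord_eq_1[of "inv g"] g gn by simp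
  then have ordy: "E.ord y = n"
    unfolding y_def using g u F.norm_sum_telescope[of u "inv g" n] by (subst F.ord_sdp_split) simp_all
  have g1: "g \<noteq> \<one>" using g by auto
  have u_delta: "u - translate g u = delta e \<one> - delta e g"
    using g by (simp add: u_def translate_delta)
  have "nmul j (u - translate g u) = 0 \<longleftrightarrow> r dvd j" for j
  proof
    assume "nmul j (u - translate g u) = 0"
    then have "nmul j ((u - translate g u) \<one>) = 0" by (metis nmul_fun zero_fun_apply)
    moreover have "(u - translate g u) \<one> = e"
      using g1 by (simp add: u_delta) (simp add: delta_def)
    ultimately show "r dvd j" using r by (simp add: e_def nmul_qz_of_inverse_eq_0_iff)
  next
    assume "r dvd j"
    then have "nmul j e = 0" using r by (simp add: e_def nmul_qz_of_inverse_eq_0_iff)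
    then show "nmul j (u - translate g u) = 0"
      by (simp add: u_delta nmul_diff_right nmul_delta_eq_0)
  qed
  then have ordxy: "E.ord (x \<otimes>\<^bsub>F.sdp\<^esub> y) = r"
    unfolding xy using g u F.ord_sdp[of "u - translate g u" \<one> r] by (simp add: F.norm_sum_one)
  have xy1: "x \<otimes>\<^bsub>F.sdp\<^esub> y \<noteq> \<one>\<^bsub>F.sdp\<^esub>"
    using ordxy r E.ord_eq_1[of "x \<otimes>\<^bsub>F.sdp\<^esub> y"] car by (auto simp del: F.sdp_simps)
  have pow_iff: "x [^]\<^bsub>F.sdp\<^esub> i = \<one>\<^bsub>F.sdp\<^esub> \<longleftrightarrow> g [^] i = \<one>" "y [^]\<^bsub>F.sdp\<^esub> i = \<one>\<^bsub>F.sdp\<^esub> \<longleftrightarrow> inv g [^] i = \<one>" for i :: nat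
    using car g gn ordx ordy by (simp_all add: E.pow_eq_id pow_eq_id del: F.sdp_simps)
  have snd_pow: "snd (x [^]\<^bsub>F.sdp\<^esub> i) = g [^] i" "snd (y [^]\<^bsub>F.sdp\<^esub> i) = inv g [^] i" for i :: nat
    using u g by (simp_all add: x_def y_def F.sdp_pow)
  have snd_mult: "snd (z \<otimes>\<^bsub>F.sdp\<^esub> w) = snd z \<otimes> snd w" for z w
    by (cases z; cases w) simp
  \<comment> \<open>Projecting to \<open>G\<close> gives \<open>g^i = 1\<close>, hence
    \<open>x^i = 1\<close> and \<open>x y = 1\<close>, against \<open>r \<ge> 2\<close>.\<close>
  have "x [^]\<^bsub>F.sdp\<^esub> i \<otimes>\<^bsub>F.sdp\<^esub> (x \<otimes>\<^bsub>F.sdp\<^esub> y) \<noteq> \<one>\<^bsub>F.sdp\<^esub>" for i :: nat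
  proof
    assume eq: "x [^]\<^bsub>F.sdp\<^esub> i \<otimes>\<^bsub>F.sdp\<^esub> (x \<otimes>\<^bsub>F.sdp\<^esub> y) = \<one>\<^bsub>F.sdp\<^esub>"
    then have "g [^] i \<otimes> \<one> = \<one>"
      by (metis snd_mult snd_pow(1) xy snd_conv F.sdp_simps(3))
    then have "x [^]\<^bsub>F.sdp\<^esub> i = \<one>\<^bsub>F.sdp\<^esub>" using g pow_iff by simp
    then show False using eq xy1 car by (simp del: F.sdp_simps)
  qed
  \<comment> \<open>Projecting shows that \<open>i + (n - 1)\<close> is a multiple of
    \<open>n\<close>, so \<open>y^i\<close> is inverse to both \<open>x\<close> and
    \<open>y^(n-1)\<close>; then \<open>x y = y^n = 1\<close>, a contradiction.\<close>
  moreover have "y [^]\<^bsub>F.sdp\<^esub> i \<otimes>\<^bsub>F.sdp\<^esub> x \<noteq> \<one>\<^bsub>F.sdp\<^esub>" for i :: nat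
  proof
    assume eq: "y [^]\<^bsub>F.sdp\<^esub> i \<otimes>\<^bsub>F.sdp\<^esub> x = \<one>\<^bsub>F.sdp\<^esub>"
    then have "inv g [^] i \<otimes> g = \<one>"
      by (metis snd_mult snd_pow(2) x_def snd_conv F.sdp_simps(3))
    moreover have "inv g [^] (n - 1) = g"
    proof -
      have "inv g [^] (n - 1) \<otimes> inv g = \<one>"
        using \<open>inv g [^] n = \<one>\<close> g by (metis One_nat_def Suc_pred less_le_trans nat_pow_Suc pos2)
      then show ?thesis using g by (metis inv_closed inv_equality inv_inv nat_pow_closed)
    qed
    ultimately have "inv g [^] (i + (n - 1)) = \<one>"
      using g nat_pow_mult[of "inv g" i "n - 1"] by simp
    then have "y [^]\<^bsub>F.sdp\<^esub> i \<otimes>\<^bsub>F.sdp\<^esub> y [^]\<^bsub>F.sdp\<^esub> (n - 1) = \<one>\<^bsub>F.sdp\<^esub>"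
      using car pow_iff(2)[of "i + (n - 1)"] by (simp add: E.nat_pow_mult del: F.sdp_simps)
    then have "x = y [^]\<^bsub>F.sdp\<^esub> (n - 1)"
      using eq car by (metis E.l_cancel E.nat_pow_closed)
    moreover have "Suc (n - 1) = n" using g by simp
    ultimately have "x \<otimes>\<^bsub>F.sdp\<^esub> y = y [^]\<^bsub>F.sdp\<^esub> n"
      using E.nat_pow_Suc by metis
    then show False using xy1 ordy E.pow_ord_eq_1[OF car(2)] by (simp del: F.sdp_simps)
  qed
  moreover have "finite (funs M)"
    unfolding M_def using r by (intro finite_funs[OF fin finite_torsion_qz]) simp
  then have "finite (carrier F.sdp)" using fin by simp
  ultimately show ?thesis
    using E.group_axioms car ordx ordy ordxy F.exp_of_derived_sdp[OF d] by blast
qed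

text \<open>Vectors \<open>v, v'\<close> are attached to \<open>x, y\<close> so that their
  contributions to the product form a principal term for \<open>z = x y\<close>, which keeps its
  order, while the norms of \<open>v\<close> under \<open>x\<close> and of \<open>v'\<close> under
  \<open>y\<close> have additive orders \<open>m\<close> and \<open>m'\<close>.\<close>

lemma exists_triple_lift:
  assumes fin: "finite (carrier G)" and x: "x \<in> carrier G" "ord x = n" and y: "y \<in> carrier G" "ord y = n"
    and ne: "\<And>i::nat. x [^] i \<otimes> (x \<otimes> y) \<noteq> \<one>" "\<And>i::nat. y [^] i \<otimes> x \<noteq> \<one>"
    and d: "(derived G ^^ d) (carrier G) = {\<one>}" and m: "m > 0" "m' > 0"
  shows "\<exists>(H :: (('a \<Rightarrow> qz) \<times> 'a) monoid) a b. group H \<and> finite (carrier H) \<and>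
    a \<in> carrier H \<and> b \<in> carrier H \<and>
    group.ord H a = n * m \<and> group.ord H b = n * m' \<and> group.ord H (a \<otimes>\<^bsub>H\<^esub> b) = ord (x \<otimes> y) \<and>
    (derived H ^^ Suc d) (carrier H) = {\<one>\<^bsub>H\<^esub>}"
proof -
  define M where "M = (torsion (m * m') :: qz set)"
  interpret F: gmod G translate "funs M" unfolding M_def by (rule gmod_funs_torsion)
  interpret E: group F.sdp by (rule F.group_sdp)
  define z where "z = x \<otimes> y"
  have z: "z \<in> carrier G" using x y by (simp add: z_def)
  define e where "e = qz_of (1 / of_nat m)"
  define e' where "e' = qz_of (1 / of_nat m')"
  have "e \<in> M" "e' \<in> M" using m by (simp_all add: e_def e'_def M_def one_over_in_torsion)
  have e: "nmul j e = 0 \<longleftrightarrow> m dvd j" "nmul j e' = 0 \<longleftrightarrow> m' dvd j" for j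
    using m by (simp_all add: e_def e'_def nmul_qz_of_inverse_eq_0_iff)
  define u where "u = delta e \<one>"
  define u' where "u' = delta e' \<one>"
  have u: "u \<in> funs M" "u' \<in> funs M"
    using \<open>e \<in> M\<close> \<open>e' \<in> M\<close> by (simp_all add: u_def u'_def delta_in_funs M_def torsion_closed)
  define v where "v = u - translate z u"
  define v' where "v' = translate (inv x) (u' - translate z u')"
  have vV: "v \<in> funs M" "v' \<in> funs M" using u x z by (simp_all add: v_def v'_def)
  have v_delta: "v = delta e \<one> - delta e z" "v' = delta e' (inv x) - delta e' y"
    using x y z by (simp_all add: v_def v'_def u_def u'_def F.act_diff translate_delta z_def inv_cancel_left)
  have ord_pos: "n > 0" using ord_ge_1[OF fin x(1)] x by simp
  have norm_delta: "F.norm_sum k h (delta c w) l = (\<Sum>i<k. if l = h [^] i \<otimes> w then c else 0)"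
    if "h \<in> carrier G" "w \<in> carrier G" for k h c w l
    using that by (simp add: F.norm_sum_def translate_delta sum_apply) (simp add: delta_def)
  have pow0: "h [^] i = \<one> \<longleftrightarrow> i = 0" if "h \<in> carrier G" "ord h = n" "i < n" for h and i :: nat
    using that by (auto simp: pow_eq_id dest: dvd_imp_le)
  \<comment> \<open>At \<open>\<one>\<close> the mass of \<open>u\<close> is met only for
    \<open>i = 0\<close>; the mass of its translate would require \<open>x^i z = 1\<close>, excluded
    by \<open>ne(1)\<close>.\<close>
  have norm_vx: "F.norm_sum n x v \<one> = e"
  proof -
    have "(if \<one> = x [^] i \<otimes> \<one> then e else 0) = (if i = 0 then e else 0)" if "i < n" for i
      using pow0[OF x that] x by auto
    then have "F.norm_sum n x (delta e \<one>) \<one> = (\<Sum>i<n. if i = 0 then e else 0)"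
      unfolding norm_delta[OF x(1) one_closed] by (intro sum.cong) auto
    then have "F.norm_sum n x v \<one> = (\<Sum>i<n. if i = 0 then e else 0) - (\<Sum>i<n. if \<one> = x [^] i \<otimes> z then e else 0)"
      using x z by (simp add: v_delta F.norm_sum_diff norm_delta)
    also have "(\<Sum>i<n. if \<one> = x [^] i \<otimes> z then e else 0) = 0"
      using ne(1) by (intro sum.neutral) (metis z_def)
    finally show ?thesis using ord_pos by simp
  qed
  \<comment> \<open>At \<open>inv x\<close> the first mass of \<open>v'\<close> is met only for
    \<open>i = 0\<close>; the second, at \<open>y\<close>, would require
    \<open>y^(i+1) x = 1\<close>, excluded by \<open>ne(2)\<close>.\<close>
  have norm_vy: "F.norm_sum n y v' (inv x) = e'"
  proof -
    have "inv x = y [^] i \<otimes> inv x \<longleftrightarrow> i = 0" if "i < n" for i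
      using pow0[OF y that] x y by (metis inv_closed l_one nat_pow_closed one_closed r_cancel)
    moreover have "inv x \<noteq> y [^] i \<otimes> y" for i :: nat
      using ne(2)[of "Suc i"] x y by (metis l_inv nat_pow_Suc)
    ultimately have "F.norm_sum n y v' (inv x) = (\<Sum>i<n. if i = 0 then e' else 0)"
      unfolding v_delta F.norm_sum_diff using x y
      by (auto simp: norm_delta intro!: sum.cong)
    then show ?thesis using ord_pos by simp
  qed
  have nmul_norm: "nmul j (F.norm_sum n h w) = F.norm_sum n h (nmul j w)" for j h w
    by (simp add: F.norm_sum_def nmul_def F.act_sum sum.swap[of _ "{..<n}"])
  have norm_zero: "F.norm_sum n h 0 = 0" for h
    by (simp add: F.norm_sum_def)
  have "nmul j (F.norm_sum n x v) = 0 \<longleftrightarrow> m dvd j" for j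
  proof
    assume "nmul j (F.norm_sum n x v) = 0"
    then have "nmul j e = 0" using norm_vx by (metis nmul_fun zero_fun_apply)
    then show "m dvd j" by (simp add: e)
  next
    assume "m dvd j"
    then show "nmul j (F.norm_sum n x v) = 0"
      by (simp add: nmul_norm v_delta nmul_diff_right nmul_delta_eq_0 e norm_zero)
  qed
  then have "E.ord (v, x) = n * m" using F.ord_sdp[OF vV(1) x(1)] x by simp
  moreover have "nmul j (F.norm_sum n y v') = 0 \<longleftrightarrow> m' dvd j" for j
  proof
    assume "nmul j (F.norm_sum n y v') = 0"
    then have "nmul j e' = 0" using norm_vy by (metis nmul_fun zero_fun_apply)
    then show "m' dvd j" by (simp add: e)
  next
    assume "m' dvd j"
    then show "nmul j (F.norm_sum n y v') = 0"
      by (simp add: nmul_norm v_delta nmul_diff_right nmul_delta_eq_0 e norm_zero)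
  qed
  then have "E.ord (v', y) = n * m'" using F.ord_sdp[OF vV(2) y(1)] y by simp
  \<comment> \<open>The translation by \<open>inv x\<close> in \<open>v'\<close> cancels against the
    action of \<open>x\<close>, leaving a vector whose norm of length \<open>ord z\<close>
    telescopes to \<open>0\<close>.\<close>
  moreover have "(v, x) \<otimes>\<^bsub>F.sdp\<^esub> (v', y) = (- (translate z (u + u') - (u + u')), z)"
    using x z u by (simp add: v'_def z_def v_def F.act_add)
  moreover have "E.ord (- (translate z (u + u') - (u + u')), z) = ord z"
  proof (rule F.ord_sdp_split)
    have "F.norm_sum k h (- w) = - F.norm_sum k h w" for k h w
      by (simp add: F.norm_sum_def F.act_uminus sum_negf)
    then show "F.norm_sum (ord z) z (- (translate z (u + u') - (u + u'))) = 0"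
      using z u by (simp only: F.norm_sum_telescope F.add_V) simp
  qed (use z u in \<open>simp_all del: F.sdp_simps\<close>)
  moreover have "(v, x) \<in> carrier F.sdp" "(v', y) \<in> carrier F.sdp" using vV x y by simp_all
  moreover have "finite (funs M)"
    unfolding M_def using m by (intro finite_funs[OF fin finite_torsion_qz]) simp
  then have "finite (carrier F.sdp)" using fin by simp
  ultimately show ?thesis
    using E.group_axioms F.exp_of_derived_sdp[OF d] unfolding z_def by metis
qed

end

text \<open>The first extension of the cyclic group of order \<open>n\<close> produces orders
  \<open>n, n, r\<close>; the second multiplies the first two by \<open>p / n\<close> and
  \<open>q / n\<close>. The derived bound grows by one each time, from \<open>1\<close> to
  \<open>3\<close>.\<close>

lemma exists_triple_common_divisor:
  assumes "2 \<le> n" "n dvd p" "n dvd q" "0 < p" "0 < q" "2 \<le> r"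
  shows "\<exists>(H :: ((((int \<Rightarrow> qz) \<times> int) \<Rightarrow> qz) \<times> (int \<Rightarrow> qz) \<times> int) monoid) a b.
    group H \<and> finite (carrier H) \<and> a \<in> carrier H \<and> b \<in> carrier H \<and>
    group.ord H a = p \<and> group.ord H b = q \<and> group.ord H (a \<otimes>\<^bsub>H\<^esub> b) = r \<and>
    (derived H ^^ 3) (carrier H) = {\<one>\<^bsub>H\<^esub>}"
proof -
  interpret C: comm_group "integer_mod_group n" by simp
  have one: "1 \<in> carrier (integer_mod_group n)" using assms by (simp add: integer_mod_group_1)
  have "C.ord 1 = n"
    unfolding C.ord_unique[OF one] using assms by (auto simp: pow_integer_mod_group mod_eq_0_iff_dvd)
  moreover have "finite (carrier (integer_mod_group n))"
    using assms by (simp add: carrier_integer_mod_group)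
  moreover have "(derived (integer_mod_group n) ^^ 1) (carrier (integer_mod_group n)) = {\<one>\<^bsub>integer_mod_group n\<^esub>}"
    using C.derived_eq_singleton[OF subset_refl] by simp
  ultimately obtain G :: "((int \<Rightarrow> qz) \<times> int) monoid" and x y where G: "group G" "finite (carrier G)"
    "x \<in> carrier G" "group.ord G x = n" "y \<in> carrier G" "group.ord G y = n"
    "\<And>i::nat. x [^]\<^bsub>G\<^esub> i \<otimes>\<^bsub>G\<^esub> (x \<otimes>\<^bsub>G\<^esub> y) \<noteq> \<one>\<^bsub>G\<^esub>" "\<And>i::nat. y [^]\<^bsub>G\<^esub> i \<otimes>\<^bsub>G\<^esub> x \<noteq> \<one>\<^bsub>G\<^esub>"
    "(derived G ^^ Suc 1) (carrier G) = {\<one>\<^bsub>G\<^esub>}" "group.ord G (x \<otimes>\<^bsub>G\<^esub> y) = r"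
    using C.exists_triple_over_cyclic[of 1 n r 1] assms one by metis
  obtain m m' where m: "p = n * m" "q = n * m'" using assms by (elim dvdE)
  then have "m > 0" "m' > 0" using assms by auto
  from group.exists_triple_lift[OF G(1-9) this] show ?thesis
    unfolding m G(10) by (simp only: numeral_3_eq_3 One_nat_def)
qed

subsection \<open>Smooth quotients of prescribed derived length\<close>

lemma (in group_hom) ord_eq_if_ord_hom:
  assumes "x \<in> carrier G" "x [^] n = \<one>" "group.ord H (h x) = n"
  shows "group.ord G x = n"
proof (rule dvd_antisym)
  show "G.ord x dvd n" using assms by (simp add: G.pow_eq_id)
  have "h x [^]\<^bsub>H\<^esub> G.ord x = \<one>\<^bsub>H\<^esub>"
    using assms(1) by (metis G.pow_ord_eq_1 hom_nat_pow hom_one)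
  then show "n dvd G.ord x" using assms by (simp add: H.pow_eq_id)
qed

context triangle
begin

lemma exists_smooth_derived_length_le_3:
  assumes pqr: "2 \<le> p" "2 \<le> q" "2 \<le> r" and np: "\<not> perfect_group T"
  shows "\<exists>N. smooth_fin_sol_quotient p q r N \<and> derived_length (T Mod N) \<le> 3"
proof -
  have "\<exists>(H :: ((((int \<Rightarrow> qz) \<times> int) \<Rightarrow> qz) \<times> (int \<Rightarrow> qz) \<times> int) monoid) a b.
    group H \<and> finite (carrier H) \<and> a \<in> carrier H \<and> b \<in> carrier H \<and>
    group.ord H a = p \<and> group.ord H b = q \<and> group.ord H (a \<otimes>\<^bsub>H\<^esub> b) = r \<and>
    (derived H ^^ 3) (carrier H) = {\<one>\<^bsub>H\<^esub>}"
  proof -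
    have common: "\<exists>n. 2 \<le> n \<and> n dvd i \<and> n dvd j" if "\<not> coprime i j" "2 \<le> i" for i j :: nat
    proof (intro exI[of _ "gcd i j"] conjI)
      have "gcd i j \<noteq> 1" using that by (simp add: coprime_iff_gcd_eq_1)
      moreover have "gcd i j \<noteq> 0" using that by simp
      ultimately show "2 \<le> gcd i j" by linarith
    qed simp_all
    consider "\<not> coprime p q" | "\<not> coprime p r" | "\<not> coprime q r"
      using perfect_if_coprime np by blast
    then show ?thesis
    proof cases
      case 1
      then show ?thesis using common[OF 1 pqr(1)] exists_triple_common_divisor[of _ p q r] pqr by force
    next
      case 2
      then obtain n where "2 \<le> n" "n dvd p" "n dvd r" using common[OF 2 pqr(1)] by blast
      then obtain H :: "((((int \<Rightarrow> qz) \<times> int) \<Rightarrow> qz) \<times> (int \<Rightarrow> qz) \<times> int) monoid" and a b where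
        H: "group H" "finite (carrier H)" "a \<in> carrier H" "b \<in> carrier H" "group.ord H a = p"
        "group.ord H b = r" "group.ord H (a \<otimes>\<^bsub>H\<^esub> b) = q" "(derived H ^^ 3) (carrier H) = {\<one>\<^bsub>H\<^esub>}"
        using exists_triple_common_divisor[of n p r q] pqr by force
      interpret group H by fact
      \<comment> \<open>Orders \<open>p, r, q\<close> of \<open>a, b, a b\<close> become
        \<open>p, q, r\<close> for \<open>a^-1\<close>, \<open>a b\<close> and their product
        \<open>b\<close>.\<close>
      have "inv\<^bsub>H\<^esub> a \<otimes>\<^bsub>H\<^esub> (a \<otimes>\<^bsub>H\<^esub> b) = b" using H by (simp add: inv_cancel_left)
      then show ?thesis
        using H by (intro exI[of _ H] exI[of _ "inv\<^bsub>H\<^esub> a"] exI[of _ "a \<otimes>\<^bsub>H\<^esub> b"]) simp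
    next
      case 3
      then obtain n where "2 \<le> n" "n dvd q" "n dvd r" using common[OF 3 pqr(2)] by blast
      then obtain H :: "((((int \<Rightarrow> qz) \<times> int) \<Rightarrow> qz) \<times> (int \<Rightarrow> qz) \<times> int) monoid" and a b where
        H: "group H" "finite (carrier H)" "a \<in> carrier H" "b \<in> carrier H" "group.ord H a = r"
        "group.ord H b = q" "group.ord H (a \<otimes>\<^bsub>H\<^esub> b) = p" "(derived H ^^ 3) (carrier H) = {\<one>\<^bsub>H\<^esub>}"
        using exists_triple_common_divisor[of n r q p] pqr by force
      interpret group H by fact
      \<comment> \<open>Orders \<open>r, q, p\<close> of \<open>a, b, a b\<close> become
        \<open>p, q, r\<close> for \<open>a b\<close>, \<open>b^-1\<close> and their product
        \<open>a\<close>.\<close>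
      have "a \<otimes>\<^bsub>H\<^esub> b \<otimes>\<^bsub>H\<^esub> inv\<^bsub>H\<^esub> b = a" using H by (simp add: m_assoc)
      then show ?thesis
        using H by (intro exI[of _ H] exI[of _ "a \<otimes>\<^bsub>H\<^esub> b"] exI[of _ "inv\<^bsub>H\<^esub> b"]) simp
    qed
  qed
  then obtain H :: "((((int \<Rightarrow> qz) \<times> int) \<Rightarrow> qz) \<times> (int \<Rightarrow> qz) \<times> int) monoid" and a b where
    H: "group H" "finite (carrier H)" "a \<in> carrier H" "b \<in> carrier H" "group.ord H a = p"
    "group.ord H b = q" "group.ord H (a \<otimes>\<^bsub>H\<^esub> b) = r" "(derived H ^^ 3) (carrier H) = {\<one>\<^bsub>H\<^esub>}"
    by blast
  interpret H: group H by fact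
  have "triangle_rels H p q r a b"
    unfolding triangle_rels_def using H by (metis H.m_closed H.pow_ord_eq_1)
  then obtain \<phi> where \<phi>: "group_hom T H \<phi>" "\<phi> x = a" "\<phi> y = b"
    using hom_exists[OF H(1,2)] by blast
  interpret \<phi>: group_hom T H \<phi> by fact
  interpret K: normal "kernel T H \<phi>" T by (rule \<phi>.normal_kernel)
  define A where "A = (derived T ^^ 3) (carrier T)"
  have "\<phi> ` A = (derived H ^^ 3) (\<phi> ` carrier T)"
    unfolding A_def by (rule \<phi>.exp_of_derived_img[symmetric]) simp
  also have "\<dots> \<subseteq> (derived H ^^ 3) (carrier H)"
    by (rule H.mono_exp_of_derived) auto
  finally have "\<phi> ` A \<subseteq> {\<one>\<^bsub>H\<^esub>}" unfolding H(8) .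
  moreover have "A \<subseteq> carrier T" unfolding A_def by (rule T.exp_of_derived_in_carrier) simp
  ultimately have A: "(derived T ^^ 3) (carrier T) \<subseteq> kernel T H \<phi>"
    unfolding A_def[symmetric] kernel_def by blast
  have "smooth_fin_sol_quotient p q r (kernel T H \<phi>)"
    by (rule kernel_smooth(1)[OF \<phi>(1) H(2) _ _ _ A]) (use H \<phi> in simp_all)
  moreover have "derived_length (T Mod kernel T H \<phi>) \<le> 3"
    unfolding K.derived_length_Mod by (rule Least_le) (rule A)
  ultimately show ?thesis by blast
qed

text \<open>The bound \<open>B\<close> is arbitrary so that the new quotient can be made larger than
  all members of a given finite collection.\<close>

lemma exists_smooth_derived_length_Suc:
  assumes pqr: "2 \<le> p" and hyp: "1 / real p + 1 / real q + 1 / real r < 1"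
    and smooth: "smooth_fin_sol_quotient p q r N"
  obtains N' where "smooth_fin_sol_quotient p q r N'"
    "derived_length (T Mod N') = Suc (derived_length (T Mod N))" "B < card (carrier (T Mod N'))"
proof -
  define D where "D n = (derived T ^^ n) (carrier T)" for n
  interpret N: normal N T using smooth by (simp add: smooth_fin_sol_quotient_def Let_def)
  interpret Q: group "T Mod N" by (rule N.factorgroup_is_group)
  interpret \<rho>: group_hom T "T Mod N" "\<lambda>t. N #>\<^bsub>T\<^esub> t"
    by (rule group_hom.intro[OF T.is_group Q.is_group])
      (simp add: group_hom_axioms_def N.r_coset_hom_Mod)
  define a where "a = N #>\<^bsub>T\<^esub> x"
  define b where "b = N #>\<^bsub>T\<^esub> y"
  have ab: "a \<in> carrier (T Mod N)" "b \<in> carrier (T Mod N)"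
    unfolding a_def b_def by (rule \<rho>.hom_closed, rule xy_carrier)+
  have c: "N #>\<^bsub>T\<^esub> (x \<otimes>\<^bsub>T\<^esub> y) = a \<otimes>\<^bsub>T Mod N\<^esub> b"
    unfolding a_def b_def by (rule \<rho>.hom_mult[OF xy_carrier])
  have fin: "finite (carrier (T Mod N))" and "solvable (T Mod N)"
    and ords: "Q.ord a = p" "Q.ord b = q" "Q.ord (a \<otimes>\<^bsub>T Mod N\<^esub> b) = r"
    using smooth unfolding smooth_fin_sol_quotient_def Let_def a_def b_def c[unfolded a_def b_def] by blast+
  define e where "e = derived_length (T Mod N)"
  have e_Least: "e = (LEAST n. D n \<subseteq> N)"
    by (simp add: e_def N.derived_length_Mod D_def)
  have "\<exists>n. D n \<subseteq> N"
    using \<open>solvable (T Mod N)\<close> N.exp_of_derived_Mod_trivial_iff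
    unfolding Q.solvable_iff_trivial_derived_seq D_def by blast
  then have De: "D e \<subseteq> N" unfolding e_Least by (rule LeastI_ex)
  have min: "\<not> D n \<subseteq> N" if "n < e" for n
    using that not_less_Least unfolding e_Least by blast
  \<comment> \<open>Length \<open>0\<close> would put \<open>x\<close> into \<open>N\<close>, but
    its image has order \<open>p \<ge> 2\<close>. Hence the last nontrivial term \<open>S\<close> of
    the derived series exists.\<close>
  have "e \<noteq> 0"
  proof
    assume "e = 0"
    then have "x \<in> N" using De xy_carrier by (auto simp: D_def)
    then have "a = \<one>\<^bsub>T Mod N\<^esub>" unfolding a_def one_FactGroup using N.r_coset_eq_iff xy_carrier by blast
    then show False using ords(1) pqr Q.ord_eq_1[OF ab(1)] by simp
  qed
  then obtain k where k: "e = Suc k" using not0_implies_Suc by blast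
  define S where "S = (derived (T Mod N) ^^ k) (carrier (T Mod N))"
  have S: "S \<lhd> T Mod N"
    unfolding S_def by (induction k) (auto simp: Q.normal_self Q.derived_is_normal)
  have S1: "S \<noteq> {\<one>\<^bsub>T Mod N\<^esub>}"
    using min[of k] N.exp_of_derived_Mod_trivial_iff[of k] by (simp only: S_def D_def k lessI) blast
  have Qe: "(derived (T Mod N) ^^ e) (carrier (T Mod N)) = {\<one>\<^bsub>T Mod N\<^esub>}"
    using De N.exp_of_derived_Mod_trivial_iff[of e] by (simp only: D_def)
  \<comment> \<open>Exceeding the group order makes \<open>l\<close> coprime to it; exceeding
    \<open>B\<close> gives the size of the new quotient.\<close>
  obtain l :: nat where l: "Factorial_Ring.prime l" "max B (order (T Mod N)) < l"
    using bigger_prime by blast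
  have n0: "order (T Mod N) > 0" using fin Q.order_gt_0_iff_finite by blast
  have "\<not> l dvd order (T Mod N)" using l n0 by (auto dest: dvd_imp_le)
  then have cop: "coprime l (order (T Mod N))" using l(1) by (rule prime_imp_coprime[rotated])
  define M where "M = (torsion l :: qz set)"
  have l2: "2 \<le> l" using l(1) by (rule prime_ge_2_nat)
  have M: "finite M" "2 \<le> card M"
    using l2 finite_torsion_qz[of l] card_torsion_qz[of l] by (simp_all add: M_def)
  interpret F: gmod "T Mod N" "Q.translate" "Q.funs M" unfolding M_def by (rule Q.gmod_funs_torsion)
  define V where "V = F.sum_zero S"
  interpret Z: gmod "T Mod N" "Q.translate" V unfolding V_def by (rule F.gmod_sum_zero[OF S])
  have VF: "V \<subseteq> Q.funs M" by (auto simp: V_def F.sum_zero_def)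
  have finV: "finite V" by (rule finite_subset[OF VF Q.finite_funs[OF fin M(1)]])
  have tf: "v = 0" if "v \<in> V" "nmul n v = 0" "n dvd order (T Mod N)" for v n
  proof -
    have "coprime l n" using cop that(3) by (meson coprime_divisors dvd_refl)
    then show ?thesis using Q.funs_torsion_free that VF unfolding M_def by blast
  qed
  have pow1: "a [^]\<^bsub>T Mod N\<^esub> p = \<one>\<^bsub>T Mod N\<^esub>" "b [^]\<^bsub>T Mod N\<^esub> q = \<one>\<^bsub>T Mod N\<^esub>"
    "(a \<otimes>\<^bsub>T Mod N\<^esub> b) [^]\<^bsub>T Mod N\<^esub> r = \<one>\<^bsub>T Mod N\<^esub>"
    using Q.pow_ord_eq_1 ab ords Q.m_closed by metis+
  have "card (Z.fixed_pts {a}) * card (Z.fixed_pts {b}) * card (Z.fixed_pts {a \<otimes>\<^bsub>T Mod N\<^esub> b}) < card V"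
    using Q.card_fixed_sum_zero_less[OF fin _ _ cop S S1 ab Q.m_closed[OF ab], where 'v = qz] M hyp
    unfolding V_def M_def ords by blast
  then obtain s where s: "s \<in> V" "Z.norm_sum r (a \<otimes>\<^bsub>T Mod N\<^esub> b) (Q.translate a s - s) = 0"
    "\<And>u. \<lbrakk>u \<in> V; Q.translate b u = u\<rbrakk> \<Longrightarrow> Q.translate a u - u \<noteq> Q.translate a s - s"
    using Z.exists_nonprincipal[OF finV ab pow1(3)] by blast
  define W where "W = Z.sdp"
  interpret W: group W unfolding W_def by (rule Z.group_sdp)
  interpret \<pi>: group_hom W "T Mod N" snd unfolding W_def by (rule Z.snd_sdp_hom)
  have finW: "finite (carrier W)" using finV fin by (simp add: W_def)
  \<comment> \<open>The derivation takes the values \<open>(a - 1) s\<close> on \<open>x\<close> and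
    \<open>0\<close> on \<open>y\<close>. The first relation holds by telescoping, the second
    because the vector is \<open>0\<close>, the third by the norm condition on
    \<open>s\<close>.\<close>
  define a' where "a' = (Q.translate a s - s, a)"
  define b' where "b' = (0 :: tword set set \<Rightarrow> qz, b)"
  have ab': "a' \<in> carrier W" "b' \<in> carrier W" using ab s by (simp_all add: a'_def b'_def W_def)
  have c': "a' \<otimes>\<^bsub>W\<^esub> b' = (Q.translate a s - s, a \<otimes>\<^bsub>T Mod N\<^esub> b)"
    by (simp add: a'_def b'_def W_def del: mult_FactGroup)
  have sV: "Q.translate a s - s \<in> V" using ab s by simp
  have pow1': "a' [^]\<^bsub>W\<^esub> p = \<one>\<^bsub>W\<^esub>" "b' [^]\<^bsub>W\<^esub> q = \<one>\<^bsub>W\<^esub>" "(a' \<otimes>\<^bsub>W\<^esub> b') [^]\<^bsub>W\<^esub> r = \<one>\<^bsub>W\<^esub>"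
  proof -
    show "a' [^]\<^bsub>W\<^esub> p = \<one>\<^bsub>W\<^esub>"
      unfolding a'_def W_def Z.sdp_pow[OF sV ab(1)] pow1(1) Z.norm_sum_telescope[OF s(1) ab(1)]
      using s(1) by (simp del: one_FactGroup)
    show "b' [^]\<^bsub>W\<^esub> q = \<one>\<^bsub>W\<^esub>"
      unfolding b'_def W_def Z.sdp_pow[OF Z.zero_V ab(2)] pow1(2) by (simp add: Z.norm_sum_def del: one_FactGroup)
    show "(a' \<otimes>\<^bsub>W\<^esub> b') [^]\<^bsub>W\<^esub> r = \<one>\<^bsub>W\<^esub>"
      unfolding c' unfolding W_def Z.sdp_pow[OF sV Q.m_closed[OF ab]] pow1(3) s(2) by (simp del: one_FactGroup)
  qed
  have "triangle_rels W p q r a' b'" using ab' pow1' by (simp add: triangle_rels_def)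
  then obtain \<phi> where \<phi>: "group_hom T W \<phi>" "\<phi> x = a'" "\<phi> y = b'"
    using hom_exists[OF W.is_group finW] by blast
  interpret \<phi>: group_hom T W \<phi> by fact
  interpret K: normal "kernel T W \<phi>" T by (rule \<phi>.normal_kernel)
  have snd_\<phi>: "snd (\<phi> t) = N #>\<^bsub>T\<^esub> t" if tT: "t \<in> carrier T" for t
  proof -
    obtain w where t: "t = evw T x y w" using tT unfolding carrier_T evw_T by blast
    have "snd (\<phi> t) = snd (evw W a' b' w)"
      unfolding t \<phi>.evw_hom[OF xy_carrier, symmetric] \<phi>(2,3) ..
    also have "\<dots> = evw (T Mod N) (snd a') (snd b') w"
      by (rule \<pi>.evw_hom[OF ab', symmetric])
    also have "\<dots> = evw (T Mod N) (N #>\<^bsub>T\<^esub> x) (N #>\<^bsub>T\<^esub> y) w"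
      by (simp add: a'_def b'_def a_def b_def)
    also have "\<dots> = N #>\<^bsub>T\<^esub> t"
      unfolding t by (rule \<rho>.evw_hom[OF xy_carrier])
    finally show ?thesis .
  qed
  have surj: "snd ` \<phi> ` carrier T = carrier (T Mod N)"
    unfolding carrier_FactGroup image_image by (rule image_cong) (simp_all add: snd_\<phi>)
  have DeSuc: "D (Suc e) \<subseteq> kernel T W \<phi>"
  proof -
    have "\<phi> ` D (Suc e) = (derived W ^^ Suc e) (\<phi> ` carrier T)"
      unfolding D_def by (rule \<phi>.exp_of_derived_img[symmetric]) simp
    also have "\<dots> \<subseteq> (derived W ^^ Suc e) (carrier W)"
      by (rule W.mono_exp_of_derived) auto
    also have "\<dots> = {\<one>\<^bsub>W\<^esub>}"
      unfolding W_def by (rule Z.exp_of_derived_sdp[OF Qe])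
    finally have "\<phi> ` D (Suc e) \<subseteq> {\<one>\<^bsub>W\<^esub>}" .
    moreover have "D (Suc e) \<subseteq> carrier T"
      unfolding D_def by (rule T.exp_of_derived_in_carrier) simp
    ultimately show ?thesis unfolding kernel_def by blast
  qed
  have De_not: "\<not> D e \<subseteq> kernel T W \<phi>"
  proof
    assume ker: "D e \<subseteq> kernel T W \<phi>"
    \<comment> \<open>On an \<open>S\<close>-fixed vector the norm of \<open>S\<close> is
      multiplication by \<open>|S|\<close>, which is injective, whereas it vanishes on all of
      \<open>V\<close>.\<close>
    have fixS: "Z.fixed_pts S = {0}"
    proof
      show "Z.fixed_pts S \<subseteq> {0}"
      proof
        fix v assume v: "v \<in> Z.fixed_pts S"
        interpret S: normal S "T Mod N" by (rule S)
        have "finite S" using S.subset fin by (rule finite_subset)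
        then have "nmul (card S) v = (\<Sum>t\<in>S. Q.translate t v)"
          using v by (simp add: Z.fixed_pts_def sum_const_nmul)
        also have "\<dots> = 0"
        proof -
          have "v \<in> F.sum_zero S" using v by (simp add: Z.fixed_pts_def flip: V_def)
          then show ?thesis unfolding F.sum_zero_def by blast
        qed
        finally have "v = 0"
        proof (rule tf[rotated])
          show "card S dvd order (T Mod N)"
            using Q.lagrange_finite[OF fin S.subgroup_axioms] by (metis dvd_triv_right)
        qed (use v in \<open>simp add: Z.fixed_pts_def\<close>)
        then show "v \<in> {0}" by simp
      qed
    qed (simp add: Z.fixed_pts_def)
    obtain u where u: "u \<in> V" "\<And>t. t \<in> carrier T \<Longrightarrow> fst (\<phi> t) = Q.translate (snd (\<phi> t)) u - u"
    proof (rule Z.derived_subset_kernel_imp_principal[OF fin finV])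
      show "v = 0" if "v \<in> V" "nmul (order (T Mod N)) v = 0" for v
        by (rule tf[OF that dvd_refl])
      show "group_hom T Z.sdp \<phi>" using \<phi>(1) by (simp only: W_def)
      show "snd ` \<phi> ` carrier T = carrier (T Mod N)" by (rule surj)
      show "Z.fixed_pts ((derived (T Mod N) ^^ k) (carrier (T Mod N))) = {0}"
        using fixS by (simp only: S_def)
      show "(derived T ^^ Suc k) (carrier T) \<subseteq> kernel T Z.sdp \<phi>"
        using ker by (simp only: D_def k W_def)
    qed blast
    \<comment> \<open>A principal derivation given by \<open>u\<close> would vanish on
      \<open>y\<close> and agree with the chosen one on \<open>x\<close>, as \<open>s(3)\<close>
      forbids.\<close>
    have "Q.translate b u = u"
      using u(2)[OF xy_carrier(2)] by (simp add: \<phi> b'_def)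
    moreover have "Q.translate a u - u = Q.translate a s - s"
      using u(2)[OF xy_carrier(1)] by (simp add: \<phi> a'_def)
    ultimately show False using s(3)[OF u(1)] by blast
  qed
  have ordW: "W.ord a' = p" "W.ord b' = q" "W.ord (a' \<otimes>\<^bsub>W\<^esub> b') = r"
  proof -
    show "W.ord a' = p"
      by (rule \<pi>.ord_eq_if_ord_hom[OF ab'(1) pow1'(1)]) (simp add: a'_def ords)
    show "W.ord b' = q"
      by (rule \<pi>.ord_eq_if_ord_hom[OF ab'(2) pow1'(2)]) (simp add: b'_def ords)
    show "W.ord (a' \<otimes>\<^bsub>W\<^esub> b') = r"
      by (rule \<pi>.ord_eq_if_ord_hom[OF W.m_closed[OF ab'] pow1'(3)]) (simp add: c' ords del: mult_FactGroup)
  qed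
  note ks = kernel_smooth[OF \<phi>(1) finW, unfolded \<phi>(2,3), OF ordW DeSuc[unfolded D_def]]
  have "derived_length (T Mod kernel T W \<phi>) = Suc e"
    unfolding K.derived_length_Mod
  proof (rule Least_equality)
    show "(derived T ^^ Suc e) (carrier T) \<subseteq> kernel T W \<phi>" using DeSuc by (simp only: D_def)
    fix n assume n: "(derived T ^^ n) (carrier T) \<subseteq> kernel T W \<phi>"
    show "Suc e \<le> n"
    proof (rule ccontr)
      assume "\<not> Suc e \<le> n"
      then have "D e \<subseteq> D n" unfolding D_def by (intro T.exp_of_derived_decreasing) simp
      then show False using n De_not unfolding D_def by blast
    qed
  qed
  moreover have "B < card (carrier (T Mod kernel T W \<phi>))"
  proof -
    \<comment> \<open>An element of \<open>D e\<close> outside the new kernel lies in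
      \<open>N\<close>, so it maps to a nonzero vector of \<open>V\<close>. That vector is killed by
      the prime \<open>l\<close>, so the image contains a cyclic group of order
      \<open>l > B\<close>.\<close>
    obtain t where t: "t \<in> D e" "t \<notin> kernel T W \<phi>" using De_not by blast
    have tT: "t \<in> carrier T" using t(1) T.exp_of_derived_in_carrier[OF subset_refl] unfolding D_def by blast
    have \<phi>t: "\<phi> t \<in> carrier W" "\<phi> t \<noteq> \<one>\<^bsub>W\<^esub>"
      using t(2) tT \<phi>.hom_closed[OF tT] unfolding kernel_def by blast+
    have "snd (\<phi> t) = \<one>\<^bsub>T Mod N\<^esub>"
      using snd_\<phi>[OF tT] t(1) De N.r_coset_eq_iff[OF tT] unfolding one_FactGroup by blast
    then obtain v where v: "\<phi> t = (v, \<one>\<^bsub>T Mod N\<^esub>)" "v \<in> V"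
      using \<phi>t(1) by (cases "\<phi> t") (auto simp: W_def)
    have "nmul l v = 0"
    proof
      fix g
      show "nmul l v g = 0 g"
        using v(2) VF by (cases "g \<in> carrier (T Mod N)") (auto simp: nmul_fun Q.funs_def M_def torsion_def)
    qed
    then have "\<phi> t [^]\<^bsub>W\<^esub> l = \<one>\<^bsub>W\<^esub>"
      unfolding v(1) W_def Z.sdp_pow[OF v(2) Q.one_closed] Z.norm_sum_one[OF v(2)] by (simp del: one_FactGroup)
    then have "W.ord (\<phi> t) dvd l" using \<phi>t(1) by (simp add: W.pow_eq_id)
    moreover have "W.ord (\<phi> t) \<noteq> 1" using \<phi>t W.ord_eq_1 by blast
    ultimately have "W.ord (\<phi> t) = l" using l(1) prime_nat_iff by blast
    then have "l = card (generate W {\<phi> t})" using W.generate_pow_card[OF \<phi>t(1)] by simp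
    also have "\<dots> \<le> card (\<phi> ` carrier T)"
    proof (rule card_mono)
      show "finite (\<phi> ` carrier T)" using finW \<phi>.hom_closed by (meson finite_subset image_subsetI)
      show "generate W {\<phi> t} \<subseteq> \<phi> ` carrier T"
        by (rule W.generate_subgroup_incl[OF _ \<phi>.img_is_subgroup]) (use tT in simp)
    qed
    finally show ?thesis using l(2) ks(2) by simp
  qed
  ultimately show thesis using that ks(1) unfolding e_def by blast
qed

text \<open>If the collection were finite, the sum of the orders of its quotients could serve as
  \<open>B\<close>, giving a member larger than that sum.\<close>

lemma infinite_smooth_derived_length_Suc:
  assumes "2 \<le> p" "1 / real p + 1 / real q + 1 / real r < 1"
    and "smooth_fin_sol_quotient p q r N" "derived_length (T Mod N) = d"
  shows "infinite {N. smooth_fin_sol_quotient p q r N \<and> derived_length (T Mod N) = Suc d}"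
proof
  let ?A = "{N. smooth_fin_sol_quotient p q r N \<and> derived_length (T Mod N) = Suc d}"
  assume fin: "finite ?A"
  obtain N' where "N' \<in> ?A" "(\<Sum>N\<in>?A. card (carrier (T Mod N))) < card (carrier (T Mod N'))"
    using exists_smooth_derived_length_Suc[OF assms(1-3)] assms(4) by blast
  then show False
    using member_le_sum[OF _ _ fin, of N' "\<lambda>N. card (carrier (T Mod N))"] by (simp add: not_less)
qed

text \<open>Induction on \<open>d\<close>: an infinite family is nonempty, and any member of it
  starts the family one step longer.\<close>

lemma infinite_smooth_derived_length_greater:
  assumes "2 \<le> p" "1 / real p + 1 / real q + 1 / real r < 1"
    and "smooth_fin_sol_quotient p q r N" "derived_length (T Mod N) < d"
  shows "infinite {N. smooth_fin_sol_quotient p q r N \<and> derived_length (T Mod N) = d}"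
proof -
  from assms(4) have "Suc (derived_length (T Mod N)) \<le> d" by simp
  then show ?thesis
  proof (induction d rule: dec_induct)
    case base
    show ?case by (rule infinite_smooth_derived_length_Suc[OF assms(1-3) refl])
  next
    case (step n)
    then obtain N' where "smooth_fin_sol_quotient p q r N'" "derived_length (T Mod N') = n"
      using not_finite_existsD by blast
    then show ?case by (rule infinite_smooth_derived_length_Suc[OF assms(1,2)])
  qed
qed

end

theorem theorem1p1:
  fixes p q r :: nat
  assumes "2 \<le> p" "2 \<le> q" "2 \<le> r"
    and "1 / real p + 1 / real q + 1 / real r < 1"
    and "\<not> perfect_group (triangle_group p q r)"
  shows "(\<exists>N. smooth_fin_sol_quotient p q r N \<and>
             derived_length (triangle_group p q r Mod N) \<le> 3)
    \<and> (\<forall>d::nat. d > (LEAST c. \<exists>N. smooth_fin_sol_quotient p q r N \<and>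
                           derived_length (triangle_group p q r Mod N) = c) \<longrightarrow>
         infinite {N. smooth_fin_sol_quotient p q r N \<and>
                      derived_length (triangle_group p q r Mod N) = d})
    \<and> (\<forall>d::nat. d > 3 \<longrightarrow>
         infinite {N. smooth_fin_sol_quotient p q r N \<and>
                      derived_length (triangle_group p q r Mod N) = d})"
proof -
  interpret triangle p q r .
  obtain N where N: "smooth_fin_sol_quotient p q r N" "derived_length (T Mod N) \<le> 3"
    using exists_smooth_derived_length_le_3[OF assms(1-3,5)] by blast
  then have "\<exists>c N. smooth_fin_sol_quotient p q r N \<and> derived_length (T Mod N) = c" by blast
  \<comment> \<open>By part (a) the minimum ranges over a nonempty set, so some \<open>N0\<close>
    attains it.\<close>
  from LeastI_ex[OF this] obtain N0 where N0: "smooth_fin_sol_quotient p q r N0"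
    "derived_length (T Mod N0) = (LEAST c. \<exists>N. smooth_fin_sol_quotient p q r N \<and> derived_length (T Mod N) = c)"
    by blast
  show ?thesis
  proof (intro conjI allI impI)
    show "\<exists>N. smooth_fin_sol_quotient p q r N \<and> derived_length (T Mod N) \<le> 3"
      using N by blast
    show "infinite {N. smooth_fin_sol_quotient p q r N \<and> derived_length (T Mod N) = d}"
      if "d > (LEAST c. \<exists>N. smooth_fin_sol_quotient p q r N \<and> derived_length (T Mod N) = c)" for d
      using that N0(2) by (intro infinite_smooth_derived_length_greater[OF assms(1,4) N0(1)]) simp
    \<comment> \<open>The quotient from part (a) has length at most \<open>3 < d\<close> and is
      itself the starting point.\<close>
    show "infinite {N. smooth_fin_sol_quotient p q r N \<and> derived_length (T Mod N) = d}" if "d > 3" for d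
      using that N(2) by (intro infinite_smooth_derived_length_greater[OF assms(1,4) N(1)]) simp
  qed
qed

end
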